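(* Let $f\in S^0(\mathbb{B}^2)$ have Taylor expansion at $0$ $$f(z_1,z_2)=\Big(z_1+\sum_{\alpha\in\mathbb{N}^2,\,|\alpha|\ge 2}a^1_\alpha z^\alpha,\ z_2+\sum_{\alpha\in\mathbb{N}^2,\,|\alpha|\ge 2}a^2_\alpha z^\alpha\Big).$$ Then $|a^1_{0,2}|\le \frac{3\sqrt3}{2}$. Moreover the bound is reached by the map $\Phi(z_1,z_2)=\left(z_1+\frac{3\sqrt3}{2}z_2^2,\ z_2\right)$, $z\in\mathbb{B}^2$, which belongs to $S^0(\mathbb{B}^2)$.
   Context: $\mathbb{B}^2=\{z\in\mathbb{C}^2:\|z\|<1\}$ is the Euclidean unit ball. Univalent means holomorphic and injective. For $\alpha=(\alpha_1,\alpha_2)\in\mathbb{N}^2$ (with $0\in\mathbb{N}$), $z^\alpha=z_1^{\alpha_1}z_2^{\alpha_2}$ and $|\alpha|=\alpha_1+\alpha_2$; $a^1_{0,2}$ is the coefficient of $z_2^2$ in the first component. A normalized Loewner chain on $\mathbb{B}^2$ is a family $(f_t)_{t\ge 0}$ of univalent maps $f_t:\mathbb{B}^2\to\mathbb{C}^2$ such that $f_s(\mathbb{B}^2)\subset f_t(\mathbb{B}^2)$ for $0\le s\le t$, $f_t(0)=0$ and $d(f_t)_0=e^t\,\mathrm{id}$ for all $t\ge 0$. It is a normal Loewner chain if moreover $\{e^{-t}f_t\}_{t\ge0}$ is a normal family in $\mathbb{B}^2$. $S^0(\mathbb{B}^2)$ is the set of univalent maps $f:\mathbb{B}^2\to\mathbb{C}^2$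 with $f(0)=0$, $df_0=\mathrm{id}$, for which there exists a normal Loewner chain $(f_t)$ with $f_0=f$. *)

theory Defs
  imports "HOL-Analysis.Analysis"
begin

abbreviation ball2 :: "(complex ^ 2) set" ("\<B>\<^sup>2")
  where "\<B>\<^sup>2 \<equiv> ball 0 1"

text \<open>Complex differentiability: the real Frechet derivative exists and is complex linear.\<close>

definition holomorphic_map_on ::
    "(complex ^ 'n \<Rightarrow> complex ^ 'm) \<Rightarrow> (complex ^ 'n) set \<Rightarrow> bool"
  where "holomorphic_map_on f U \<longleftrightarrow>
    (\<forall>z\<in>U. \<exists>D. (f has_derivative D) (at z) \<and> (\<forall>c h. D (c *s h) = c *s D h))"

definition univalent_on ::
    "(complex ^ 'n \<Rightarrow> complex ^ 'm) \<Rightarrow> (complex ^ 'n) set \<Rightarrow> bool"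
  where "univalent_on f U \<longleftrightarrow> holomorphic_map_on f U \<and> inj_on f U"

definition normalized_Loewner_chain :: "(real \<Rightarrow> complex ^ 2 \<Rightarrow> complex ^ 2) \<Rightarrow> bool"
  where "normalized_Loewner_chain F \<longleftrightarrow>
    (\<forall>t\<ge>0. univalent_on (F t) \<B>\<^sup>2) \<and>
    (\<forall>s t. 0 \<le> s \<and> s \<le> t \<longrightarrow> F s ` \<B>\<^sup>2 \<subseteq> F t ` \<B>\<^sup>2) \<and>
    (\<forall>t\<ge>0. F t 0 = 0 \<and> (F t has_derivative (\<lambda>h. exp t *\<^sub>R h)) (at 0))"

text \<open>Normality in the sense of Montel: locally uniform subsequential convergence to a finite
  limit. The variant that also admits compact divergence gives the same notion for families of
  maps fixing the origin, the only ones considered below.\<close>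

definition normal_family_on ::
    "('a::topological_space \<Rightarrow> 'b::metric_space) set \<Rightarrow> 'a set \<Rightarrow> bool"
  where "normal_family_on \<F> U \<longleftrightarrow>
    (\<forall>\<phi>::nat \<Rightarrow> 'a \<Rightarrow> 'b. range \<phi> \<subseteq> \<F> \<longrightarrow>
      (\<exists>r g. strict_mono r \<and>
        (\<forall>K. compact K \<and> K \<subseteq> U \<longrightarrow> uniform_limit K (\<phi> \<circ> r) g sequentially)))"

definition normal_Loewner_chain :: "(real \<Rightarrow> complex ^ 2 \<Rightarrow> complex ^ 2) \<Rightarrow> bool"
  where "normal_Loewner_chain F \<longleftrightarrow>
    normalized_Loewner_chain F \<and>
    normal_family_on {(\<lambda>z. exp (- t) *\<^sub>R F t z) | t. 0 \<le> t} \<B>\<^sup>2"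

text \<open>Maps on the ball are represented by total functions whose values outside the ball are
  irrelevant, so equality of maps is equality on the ball.\<close>

definition S0 :: "(complex ^ 2 \<Rightarrow> complex ^ 2) set"
  where "S0 = {f. univalent_on f \<B>\<^sup>2 \<and> f 0 = 0 \<and> (f has_derivative (\<lambda>h. h)) (at 0) \<and>
    (\<exists>F. normal_Loewner_chain F \<and> (\<forall>z\<in>\<B>\<^sup>2. F 0 z = f z))}"

text \<open>\<open>a i \<alpha>\<close> is the coefficient \<open>a\<^sup>i\<^sub>\<alpha>\<close>; only the values with \<open>|\<alpha>| \<ge> 2\<close> matter.
  As an expansion at the origin, the identity is only required near the origin.\<close>

definition has_Taylor_expansion ::
    "(complex ^ 2 \<Rightarrow> complex ^ 2) \<Rightarrow> (2 \<Rightarrow> nat \<times> nat \<Rightarrow> complex) \<Rightarrow> bool"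
  where "has_Taylor_expansion f a \<longleftrightarrow>
    (\<forall>\<^sub>F z in nhds 0. \<forall>i.
      ((\<lambda>(j, k). a i (j, k) * ((z $ 1) ^ j * (z $ 2) ^ k)) has_sum (f z $ i - z $ i))
        {(j, k). j + k \<ge> 2})"

definition \<Phi> :: "complex ^ 2 \<Rightarrow> complex ^ 2"
  where "\<Phi> z = vector [z $ 1 + of_real (3 * sqrt 3 / 2) * (z $ 2)\<^sup>2, z $ 2]"

end

theory Submission
  imports Defs "HOL-Complex_Analysis.Conformal_Mappings"
begin

text \<open>
  Let \<open>(f\<^sub>t)\<close> be a normal Loewner chain starting at \<open>f\<close> and let \<open>a\<^sub>t\<close> be the coefficient of
  \<open>z\<^sub>2\<^sup>2\<close> in the first component of \<open>f\<^sub>t\<close> (\<open>quad_coeff\<close>). For \<open>s \<le> t\<close> the transition map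
  \<open>\<phi> = f\<^sub>t\<^sup>-\<^sup>1 \<circ> f\<^sub>s\<close> sends the ball into itself and has linear part \<open>l id\<close> with \<open>l = e\<^sup>s\<^sup>-\<^sup>t\<close>. Comparing
  coefficients in \<open>f\<^sub>s = f\<^sub>t \<circ> \<phi>\<close>, its own coefficient of \<open>z\<^sub>2\<^sup>2\<close> is \<open>b = e\<^sup>-\<^sup>t (a\<^sub>s - l\<^sup>2 a\<^sub>t)\<close>.

  The shear \<open>(z\<^sub>1, z\<^sub>2) \<mapsto> (l z\<^sub>1 + b z\<^sub>2\<^sup>2, l z\<^sub>2)\<close> is the average of \<open>\<phi>\<close> over the circle action
  \<open>(\<zeta>\<^sup>2 z\<^sub>1, \<zeta> z\<^sub>2)\<close>, so it maps the ball into itself as well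
  (\<open>transition_map_bound\<close>). Testing this at the maximum of \<open>x y\<^sup>2\<close> on the sphere gives
  \<open>l \<bar>b\<bar> \<le> (3 \<surd>3 / 4) (1 - l\<^sup>2)\<close> (\<open>shear_coefficient_bound\<close>). Hence
  \<open>B\<^sub>t = e\<^sup>-\<^sup>2\<^sup>t a\<^sub>t\<close> changes over a short time interval by at most \<open>3 \<surd>3 / 2\<close> times the change of
  \<open>e\<^sup>-\<^sup>t\<close>, up to a factor that tends to \<open>1\<close> with the length of the interval
  (\<open>Loewner_chain_step\<close>). Normality bounds \<open>e\<^sup>-\<^sup>t a\<^sub>t\<close> along a sequence of times tending to
  infinity, so \<open>B\<^sub>t\<close> tends to \<open>0\<close> along it; summing the increments bounds \<open>B\<^sub>0 = a\<^sub>0\<close> by \<open>3 \<surd>3 / 2\<close>.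

  The average of \<open>\<phi>\<close> only involves the values of \<open>\<phi>\<close> on the discs \<open>\<zeta> \<mapsto> (x \<zeta>\<^sup>2, y \<zeta>)\<close>, and
  the estimate is the maximum principle on such a disc. There \<open>\<phi>\<close> is continuous by invariance of
  domain, and it is holomorphic where the Jacobian determinant of \<open>f\<^sub>t\<close> does not vanish. The
  maximum principle is therefore used in a form that tolerates the zeros of an auxiliary
  function, here that determinant along the disc (\<open>maximum_modulus_off_zero_set\<close>).

  For \<open>\<Phi>\<close> the chain is \<open>f\<^sub>t = e\<^sup>t \<Phi>\<close>. Its transition maps are the shears
  \<open>(l z\<^sub>1 + (l - l\<^sup>2) q z\<^sub>2\<^sup>2, l z\<^sub>2)\<close> with \<open>q = 3 \<surd>3 / 2\<close>. They preserve the ball because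
  the squared norm of the image is increasing in \<open>l\<close> as long as it stays below \<open>1\<close>
  (\<open>shear_flow_stays_in_ball\<close>).
\<close>

section \<open>Estimates in one complex variable\<close>

text \<open>Points within \<open>R/3\<close> of the origin are centres of discs of radius \<open>R/3\<close> inside the given one,
  so Cauchy's estimate bounds the next derivative there. What matters later is that the constant
  depends only on \<open>n\<close>, \<open>M\<close> and \<open>R\<close>.\<close>

lemma Taylor_remainder_bound:
  fixes p :: "complex \<Rightarrow> complex"
  assumes hol: "p holomorphic_on ball 0 R" and "0 < R"
    and bd: "\<And>z. z \<in> ball 0 R \<Longrightarrow> cmod (p z) \<le> M"
    and z: "cmod z \<le> R / 3"
  shows "cmod (p z - (\<Sum>i\<le>n. (deriv ^^ i) p 0 * z ^ i / fact i))
    \<le> (fact (Suc n) * (M + 1) / (R/3) ^ Suc n / fact n) * cmod z ^ Suc n"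
proof -
  let ?B = "fact (Suc n) * (M + 1) / (R/3) ^ Suc n"
  have bound: "cmod ((deriv ^^ Suc n) p w) \<le> ?B" if w: "w \<in> cball 0 (R/3)" for w
  proof (rule Cauchy_higher_deriv_bound)
    have sub: "cball w (R/3) \<subseteq> ball 0 R"
    proof
      fix u assume u: "u \<in> cball w (R/3)"
      have "cmod u \<le> cmod (u - w) + cmod w" by (metis add.commute norm_triangle_sub)
      also have "\<dots> < R" using u w \<open>0 < R\<close> by (simp add: dist_norm norm_minus_commute)
      finally show "u \<in> ball 0 R" by simp
    qed
    show "p holomorphic_on ball w (R/3)" using hol sub ball_subset_cball holomorphic_on_subset by blast
    show "continuous_on (cball w (R/3)) p"
      using hol sub holomorphic_on_imp_continuous_on holomorphic_on_subset by blast
    show "p u \<in> ball 0 (M + 1)" if "u \<in> ball w (R/3)" for u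
    proof -
      have "u \<in> ball 0 R" using sub that ball_subset_cball by blast
      then show ?thesis using bd[of u] by simp
    qed
  qed (use \<open>0 < R\<close> in auto)
  have "cmod ((deriv ^^ 0) p z - (\<Sum>i\<le>n. (deriv ^^ i) p 0 * (z - 0) ^ i / fact i))
      \<le> ?B * cmod (z - 0) ^ Suc n / fact n"
  proof (rule complex_Taylor[where f = "\<lambda>i. (deriv ^^ i) p" and S = "cball 0 (R/3)"])
    fix i x assume "x \<in> cball (0::complex) (R/3)" "i \<le> n"
    then have x: "x \<in> ball 0 R" using \<open>0 < R\<close> by auto
    show "((deriv ^^ i) p has_field_derivative (deriv ^^ Suc i) p x) (at x within cball 0 (R/3))"
      by (rule has_field_derivative_at_within[OF has_field_derivative_higher_deriv[OF hol open_ball x]])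
  next
    show "0 \<in> cball (0::complex) (R/3)" "z \<in> cball 0 (R/3)" using z \<open>0 < R\<close> by auto
  qed (rule convex_cball, rule bound)
  then show ?thesis by (simp only: funpow_0 diff_zero times_divide_eq_left)
qed

lemma quadratic_coefficient:
  fixes p :: "complex \<Rightarrow> complex"
  assumes hol: "p holomorphic_on ball 0 1" and "p 0 = 0" "deriv p 0 = 0"
  shows "((\<lambda>z. p z / z\<^sup>2) \<longlongrightarrow> (deriv ^^ 2) p 0 / 2) (at 0)"
proof -
  have cont: "continuous_on (cball 0 (1/2)) p"
    by (rule continuous_on_subset[OF holomorphic_on_imp_continuous_on[OF hol]]) auto
  then obtain M where M: "\<And>z. z \<in> cball 0 (1/2) \<Longrightarrow> cmod (p z) \<le> M"
    using continuous_on_compact_bound[OF compact_cball] by metis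
  define C where "C = fact (Suc 2) * (M + 1) / ((1/2)/3) ^ Suc 2 / fact 2"
  have rem: "cmod (p z - (deriv ^^ 2) p 0 / 2 * z\<^sup>2) \<le> C * cmod z ^ Suc 2" if "cmod z \<le> 1/6" for z
  proof -
    have "cmod (p z - (\<Sum>i\<le>2. (deriv ^^ i) p 0 * z ^ i / fact i))
        \<le> (fact (Suc 2) * (M + 1) / ((1/2)/3) ^ Suc 2 / fact 2) * cmod z ^ Suc 2"
    proof (rule Taylor_remainder_bound)
      show "p holomorphic_on ball 0 (1/2)" using hol by (rule holomorphic_on_subset) auto
      show "cmod (p z) \<le> M" if "z \<in> ball 0 (1/2)" for z using M[of z] that by auto
    qed (use that in auto)
    moreover have "(\<Sum>i\<le>2. (deriv ^^ i) p 0 * z ^ i / fact i) = (deriv ^^ 2) p 0 / 2 * z\<^sup>2"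
      using assms by (simp add: numeral_2_eq_2 fact_numeral)
    ultimately show ?thesis unfolding C_def by (simp only: Suc_eq_plus1)
  qed
  have "((\<lambda>z. p z / z\<^sup>2 - (deriv ^^ 2) p 0 / 2) \<longlongrightarrow> 0) (at 0)"
  proof (rule Lim_null_comparison)
    show "\<forall>\<^sub>F z in at 0. cmod (p z / z\<^sup>2 - (deriv ^^ 2) p 0 / 2) \<le> C * cmod z"
      unfolding eventually_at
    proof (intro exI conjI ballI impI)
      fix z :: complex assume "z \<noteq> 0 \<and> dist z 0 < 1/6"
      then have nz: "z \<noteq> 0" and le: "cmod z \<le> 1/6" by auto
      have "p z / z\<^sup>2 - (deriv ^^ 2) p 0 / 2 = (p z - (deriv ^^ 2) p 0 / 2 * z\<^sup>2) / z\<^sup>2"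
        using nz by (simp add: field_simps)
      then have "cmod (p z / z\<^sup>2 - (deriv ^^ 2) p 0 / 2) = cmod (p z - (deriv ^^ 2) p 0 / 2 * z\<^sup>2) / cmod z ^ 2"
        by (simp add: norm_divide norm_power)
      also have "\<dots> \<le> C * cmod z ^ Suc 2 / cmod z ^ 2"
        using rem[OF le] by (rule divide_right_mono) simp
      also have "\<dots> = C * cmod z" using nz by (simp add: power2_eq_square power3_eq_cube)
      finally show "cmod (p z / z\<^sup>2 - (deriv ^^ 2) p 0 / 2) \<le> C * cmod z" .
    qed auto
    show "((\<lambda>z. C * cmod z) \<longlongrightarrow> 0) (at (0::complex))"
      by (rule tendsto_eq_intros | simp)+
  qed
  then show ?thesis by (simp add: LIM_zero_iff)
qed

text \<open>This is the first step in the proof of Rado's theorem. The frontier of \<open>{h \<noteq> 0}\<close> in the disc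
  consists of points of the unit circle and of zeros of \<open>h\<close>, so the maximum principle for
  \<open>W\<^sup>n h\<close> sees the bound on the circle only. Taking \<open>n\<close>-th roots removes \<open>h\<close> from the estimate.\<close>

lemma maximum_modulus_off_zero_set:
  fixes h W :: "complex \<Rightarrow> complex"
  assumes ch: "continuous_on (cball 0 1) h" and cW: "continuous_on (cball 0 1) W"
    and hol: "h holomorphic_on {z \<in> ball 0 1. h z \<noteq> 0}" "W holomorphic_on {z \<in> ball 0 1. h z \<noteq> 0}"
    and h0: "h 0 \<noteq> 0" and le: "\<And>z. z \<in> sphere 0 1 \<Longrightarrow> cmod (W z) \<le> M"
  shows "cmod (W 0) \<le> M"
proof (rule ccontr)
  assume "\<not> ?thesis"
  then have lt: "M < cmod (W 0)" by simp
  have "0 \<le> M" using order_trans[OF norm_ge_zero le[of 1]] by simp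
  define S where "S = {z \<in> ball 0 1. h z \<noteq> 0}"
  have "S = ball 0 1 \<inter> h -` (- {0})" by (auto simp: S_def)
  then have oS: "open S"
    using continuous_open_preimage[OF continuous_on_subset[OF ch ball_subset_cball] open_ball, of "- {0}"]
    by (simp add: open_Compl)
  have SC: "closure S \<subseteq> cball 0 1" by (rule closure_minimal) (auto simp: S_def)
  obtain K where "K \<ge> 0" and K: "\<And>z. z \<in> cball 0 1 \<Longrightarrow> cmod (h z) \<le> K"
    using continuous_on_compact_bound[OF compact_cball ch] by metis
  have *: "cmod (W 0) ^ n * cmod (h 0) \<le> M ^ n * K" for n
  proof -
    have "cmod (W 0 ^ n * h 0) \<le> M ^ n * K"
    proof (rule maximum_modulus_frontier[of "\<lambda>z. W z ^ n * h z" S])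
      show "(\<lambda>z. W z ^ n * h z) holomorphic_on interior S"
        using hol oS by (auto simp: S_def interior_open intro!: holomorphic_intros)
      show "continuous_on (closure S) (\<lambda>z. W z ^ n * h z)"
        by (intro continuous_intros continuous_on_subset[OF ch SC] continuous_on_subset[OF cW SC])
      show "bounded S" by (rule bounded_subset[OF bounded_ball[of 0 1]]) (auto simp: S_def)
      show "0 \<in> S" using h0 by (simp add: S_def)
      fix z assume "z \<in> frontier S"
      then have z: "z \<in> cball 0 1" "z \<notin> S" using SC oS by (auto simp: frontier_def interior_open)
      show "cmod (W z ^ n * h z) \<le> M ^ n * K"
      proof (cases "h z = 0")
        case False
        then have "z \<in> sphere 0 1" using z by (auto simp: S_def)
        then show ?thesis
          using le[of z] K[OF z(1)] by (simp add: norm_mult norm_power mult_mono power_mono \<open>0 \<le> M\<close>)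
      qed (use \<open>0 \<le> M\<close> \<open>0 \<le> K\<close> in simp)
    qed
    then show ?thesis by (simp add: norm_mult norm_power)
  qed
  have W0: "0 < cmod (W 0)" using lt \<open>0 \<le> M\<close> by linarith
  have "(\<lambda>n. (M / cmod (W 0)) ^ n * K) \<longlonglongrightarrow> 0 * K"
    using lt \<open>0 \<le> M\<close> W0 by (intro tendsto_mult LIMSEQ_power_zero tendsto_const) simp
  moreover have "\<exists>N. \<forall>n\<ge>N. cmod (h 0) \<le> (M / cmod (W 0)) ^ n * K"
    using * W0 by (simp add: power_divide field_simps)
  ultimately have "cmod (h 0) \<le> 0 * K" by (rule LIMSEQ_le_const)
  then show False using h0 by simp
qed

section \<open>Holomorphic maps along complex discs\<close>

lemma norm_complex2: "(norm (z :: complex^2))\<^sup>2 = (cmod (z $ 1))\<^sup>2 + (cmod (z $ 2))\<^sup>2"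
  by (simp add: norm_vec_def L2_set_def sum_2)

lemma norm_complex_scale: "norm (c *s v) = cmod c * norm (v :: complex^'n)"
  by (simp add: norm_vec_def norm_mult L2_set_right_distrib)

lemma vec_has_derivative:
  fixes g :: "'a::real_normed_vector \<Rightarrow> 'b::euclidean_space ^ 'n"
  assumes "\<And>i. ((\<lambda>z. g z $ i) has_derivative (\<lambda>h. D h $ i)) (at z within S)"
  shows "(g has_derivative D) (at z within S)"
proof -
  have lin: "bounded_linear (\<lambda>h. D h $ i)" for i
    using assms has_derivative_bounded_linear by blast
  have "bounded_linear D"
  proof
    show "D (x + y) = D x + D y" for x y
      using linear_add[OF bounded_linear.linear[OF lin]] by (simp add: vec_eq_iff)
    show "D (r *\<^sub>R x) = r *\<^sub>R D x" for r x
      using linear_scale[OF bounded_linear.linear[OF lin]] by (simp add: vec_eq_iff)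
    have "\<forall>i. \<exists>K. \<forall>x. norm (D x $ i) \<le> norm x * K"
      using lin bounded_linear.bounded by blast
    then obtain K where K: "\<And>i x. norm (D x $ i) \<le> norm x * K i" by metis
    have "norm (D x) \<le> norm x * (\<Sum>i\<in>UNIV. K i)" for x
    proof -
      have "norm (D x) \<le> (\<Sum>i\<in>UNIV. norm (D x $ i))"
        unfolding norm_vec_def by (rule L2_set_le_sum) simp
      also have "\<dots> \<le> (\<Sum>i\<in>UNIV. norm x * K i)" by (rule sum_mono) (rule K)
      finally show ?thesis by (simp add: sum_distrib_left)
    qed
    then show "\<exists>K. \<forall>x. norm (D x) \<le> norm x * K" by blast
  qed
  moreover have "((\<lambda>y. (1 / norm (y - z)) *\<^sub>R (g y - (g z + D (y - z)))) \<longlongrightarrow> 0) (at z within S)"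
    using assms by (intro vec_tendstoI) (simp add: has_derivative_within)
  ultimately show ?thesis by (simp add: has_derivative_within)
qed

text \<open>Holomorphic discs in \<open>\<complex>\<^sup>n\<close> are handled through total derivatives of the form
  \<open>\<lambda>h. h *s v\<close>, where \<open>v\<close> is the complex tangent vector; this and the next lemma translate
  between that form and componentwise complex derivatives.\<close>

lemma curve_has_derivative:
  fixes g :: "complex \<Rightarrow> complex ^ 'n"
  assumes "\<And>i. ((\<lambda>z. g z $ i) has_field_derivative v $ i) (at z)"
  shows "(g has_derivative (\<lambda>h. h *s v)) (at z)"
  using assms by (intro vec_has_derivative) (simp add: has_field_derivative_def mult.commute[of _ "v $ _"])

lemma curve_derivative_component:
  fixes g :: "complex \<Rightarrow> complex ^ 'n"
  assumes "(g has_derivative (\<lambda>h. h *s v)) (at z)"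
  shows "((\<lambda>z. g z $ i) has_field_derivative v $ i) (at z)"
  using bounded_linear.has_derivative[OF bounded_linear_vec_nth assms, of i]
  by (simp add: has_field_derivative_def mult.commute[of _ "v $ _"])

lemma holomorphic_map_on_frechet:
  assumes "holomorphic_map_on f U" "z \<in> U"
  shows "(f has_derivative frechet_derivative f (at z)) (at z)"
    and "frechet_derivative f (at z) (c *s h) = c *s frechet_derivative f (at z) h"
proof -
  obtain D where D: "(f has_derivative D) (at z)" "\<And>c h. D (c *s h) = c *s D h"
    using assms unfolding holomorphic_map_on_def by blast
  have "frechet_derivative f (at z) = D" using frechet_derivative_at[OF D(1)] by simp
  then show "(f has_derivative frechet_derivative f (at z)) (at z)"
    "frechet_derivative f (at z) (c *s h) = c *s frechet_derivative f (at z) h" using D by auto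
qed

lemma holomorphic_map_on_imp_continuous_on:
  assumes "holomorphic_map_on f U" shows "continuous_on U f"
  by (intro continuous_at_imp_continuous_on ballI)
    (rule has_derivative_continuous[OF holomorphic_map_on_frechet(1)[OF assms]])

lemma holomorphic_map_along_curve:
  assumes "holomorphic_map_on f U" "g z \<in> U" "(g has_derivative (\<lambda>h. h *s v)) (at z)"
  shows "((\<lambda>z. f (g z)) has_derivative (\<lambda>h. h *s frechet_derivative f (at (g z)) v)) (at z)"
  using has_derivative_compose[OF assms(3) holomorphic_map_on_frechet(1)[OF assms(1,2)]]
  by (simp add: holomorphic_map_on_frechet(2)[OF assms(1,2)])

lemma holomorphic_on_curveI:
  assumes "holomorphic_map_on f U" "open S" "g ` S \<subseteq> U" "\<And>i. (\<lambda>z. g z $ i) holomorphic_on S"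
  shows "(\<lambda>z. f (g z) $ i) holomorphic_on S"
proof (rule holomorphic_onI)
  fix z assume z: "z \<in> S"
  have "((\<lambda>z. g z $ i) has_field_derivative (\<chi> i. deriv (\<lambda>z. g z $ i) z) $ i) (at z)" for i
    using holomorphic_derivI[OF assms(4,2) z] by simp
  from curve_derivative_component[OF holomorphic_map_along_curve[OF assms(1) _ curve_has_derivative[OF this]]]
  show "(\<lambda>z. f (g z) $ i) field_differentiable at z within S"
    using z assms(3) by (meson field_differentiable_at_within field_differentiable_def image_subset_iff)
qed

text \<open>Restricted to the complex line through \<open>w\<close> in the direction of \<open>v\<close> this is the one-variable
  Taylor estimate. All these lines meet the ball of radius \<open>(1 + r) / 2\<close> in discs of radius at
  least \<open>(1 - r) / 2\<close>, on which \<open>f\<close> is uniformly bounded; hence a single \<open>C\<close> serves all \<open>w\<close>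
  and \<open>v\<close>.\<close>

lemma holomorphic_map_second_order:
  fixes f :: "complex^2 \<Rightarrow> complex^2"
  assumes f: "holomorphic_map_on f (ball 0 1)" and "r < 1"
  obtains C \<rho> where "\<rho> > 0" "r + \<rho> < 1"
    "\<And>w v. norm w \<le> r \<Longrightarrow> norm v \<le> \<rho> \<Longrightarrow>
       cmod (f (w + v) $ i - f w $ i - frechet_derivative f (at w) v $ i) \<le> C * (norm v)\<^sup>2"
proof -
  define R where "R = (1 - r) / 2"
  have R: "0 < R" "r + R < 1" using \<open>r < 1\<close> by (auto simp: R_def field_simps)
  have cont: "continuous_on (cball 0 (r + R)) (\<lambda>w. f w $ i)"
    using R by (intro continuous_intros continuous_on_subset[OF holomorphic_map_on_imp_continuous_on[OF f]]) auto
  obtain M where M: "\<And>z. z \<in> cball 0 (r + R) \<Longrightarrow> cmod (f z $ i) \<le> M"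
    using continuous_on_compact_bound[OF compact_cball cont] by metis
  define C where "C = fact (Suc 1) * (M + 1) / (R/3) ^ Suc 1 / fact 1"
  have "cmod (f (w + v) $ i - f w $ i - frechet_derivative f (at w) v $ i) \<le> C * (norm v)\<^sup>2"
    if w: "norm w \<le> r" and v: "norm v \<le> R/3" for w v
  proof (cases "v = 0")
    case True
    have "w \<in> \<B>\<^sup>2" using w \<open>r < 1\<close> by simp
    then have "frechet_derivative f (at w) 0 = 0"
      using linear_0[OF has_derivative_linear[OF holomorphic_map_on_frechet(1)[OF f]]] by blast
    then show ?thesis using True by simp
  next
    case False
    define e where "e = (1 / norm v) *\<^sub>R v"
    have e: "norm e = 1" "v = of_real (norm v) *s e"
      using False unfolding e_def
      by (simp, simp only: vec_eq_iff vector_smult_component vector_scaleR_component)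
        (simp add: scaleR_conv_of_real)
    define g where "g = (\<lambda>\<zeta>. w + \<zeta> *s e)"
    have nse: "norm (\<zeta> *s e) = cmod \<zeta>" for \<zeta> :: complex
      using e(1) by (simp add: norm_complex_scale)
    have gin: "g \<zeta> \<in> cball 0 (r + R)" if "cmod \<zeta> < R" for \<zeta>
      using norm_triangle_ineq[of w "\<zeta> *s e"] that w nse[of \<zeta>] by (simp add: g_def)
    have ghol: "(\<lambda>\<zeta>. g \<zeta> $ j) holomorphic_on S" for j S
      unfolding g_def by (auto intro!: holomorphic_intros)
    define p where "p = (\<lambda>\<zeta>. f (g \<zeta>) $ i)"
    have pd: "deriv p 0 = frechet_derivative f (at w) e $ i"
    proof -
      have "(g has_derivative (\<lambda>h. h *s e)) (at 0)" unfolding g_def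
        by (intro curve_has_derivative) (auto intro!: derivative_eq_intros)
      moreover have "g 0 = w" by (simp add: g_def)
      ultimately have "((\<lambda>z. f (g z)) has_derivative (\<lambda>h. h *s frechet_derivative f (at w) e)) (at 0)"
        using holomorphic_map_along_curve[OF f, of g 0 e] w \<open>r < 1\<close> by simp
      from curve_derivative_component[OF this] show ?thesis unfolding p_def by (rule DERIV_imp_deriv)
    qed
    have "cmod (p (norm v) - (\<Sum>i\<le>1. (deriv ^^ i) p 0 * of_real (norm v) ^ i / fact i))
        \<le> C * cmod (norm v) ^ Suc 1"
      unfolding C_def
    proof (rule Taylor_remainder_bound)
      show "p holomorphic_on ball 0 R" unfolding p_def
      proof (rule holomorphic_on_curveI[OF f _ _ ghol])
        show "g ` ball 0 R \<subseteq> \<B>\<^sup>2"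
        proof
          fix u assume "u \<in> g ` ball 0 R"
          then have "u \<in> cball 0 (r + R)" using gin by auto
          then show "u \<in> \<B>\<^sup>2" using R(2) by simp
        qed
      qed simp
      show "cmod (p z) \<le> M" if "z \<in> ball 0 R" for z
        unfolding p_def by (rule M[OF gin]) (use that in simp)
      show "cmod (norm v) \<le> R / 3" using v by simp
    qed (rule R)
    moreover have "p (norm v) = f (w + v) $ i" "p 0 = f w $ i"
      unfolding p_def g_def using e(2)[symmetric] by simp_all
    moreover have "frechet_derivative f (at w) v $ i = of_real (norm v) * deriv p 0"
    proof -
      have "w \<in> \<B>\<^sup>2" using w \<open>r < 1\<close> by simp
      from holomorphic_map_on_frechet(2)[OF f this, of "of_real (norm v)" e]
      show ?thesis unfolding pd e(2)[symmetric] by (metis vector_smult_component)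
    qed
    moreover have "(\<Sum>i\<le>1. (deriv ^^ i) p 0 * of_real (norm v) ^ i / fact i) = p 0 + of_real (norm v) * deriv p 0"
      by simp
    ultimately show ?thesis by (simp only: norm_of_real abs_norm_cancel diff_diff_add Suc_1)
  qed
  moreover have "R/3 > 0" "r + R/3 < 1" using R by auto
  ultimately show ?thesis using that[of "R/3" C] by simp
qed

text \<open>The uniform remainder estimate makes difference quotients converge uniformly on smaller balls.
  The two lemmas that follow draw the consequences: directional derivatives inherit
  continuity, and holomorphy along discs, from the difference quotients. The step sizes keep
  \<open>w + \<epsilon> n e\<close> inside the unit ball.\<close>

lemma directional_derivative_uniform_limit:
  fixes f :: "complex^2 \<Rightarrow> complex^2"
  assumes f: "holomorphic_map_on f \<B>\<^sup>2" and "r < 1" and e: "norm e = 1"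
  obtains \<epsilon> :: "nat \<Rightarrow> real" where "\<And>n. 0 < \<epsilon> n" "\<And>n. r + \<epsilon> n < 1"
    "uniform_limit (cball 0 r) (\<lambda>n w. (f (w + of_real (\<epsilon> n) *s e) $ i - f w $ i) / of_real (\<epsilon> n))
       (\<lambda>w. frechet_derivative f (at w) e $ i) sequentially"
proof -
  obtain C \<rho> where \<rho>: "\<rho> > 0" "r + \<rho> < 1"
    and C: "\<And>w v. norm w \<le> r \<Longrightarrow> norm v \<le> \<rho> \<Longrightarrow>
       cmod (f (w + v) $ i - f w $ i - frechet_derivative f (at w) v $ i) \<le> C * (norm v)\<^sup>2"
    by (rule holomorphic_map_second_order[OF f \<open>r < 1\<close>, of i]) (rule that)
  define \<epsilon> where "\<epsilon> = (\<lambda>n. \<rho> / real (Suc n))"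
  have pos: "0 < \<epsilon> n" for n using \<rho> by (simp add: \<epsilon>_def)
  have le: "\<epsilon> n \<le> \<rho>" for n using \<rho> by (simp add: \<epsilon>_def field_simps)
  have lim: "(\<lambda>n. C * \<epsilon> n) \<longlonglongrightarrow> 0"
    unfolding \<epsilon>_def using tendsto_mult[OF tendsto_const[of "C * \<rho>"] LIMSEQ_inverse_real_of_nat]
    by (simp add: field_simps)
  have bd: "cmod ((f (w + of_real (\<epsilon> n) *s e) $ i - f w $ i) / of_real (\<epsilon> n)
      - frechet_derivative f (at w) e $ i) \<le> C * \<epsilon> n" if w: "w \<in> cball 0 r" for w n
  proof -
    have wB: "w \<in> \<B>\<^sup>2" and wr: "norm w \<le> r" using w \<open>r < 1\<close> by auto
    have nv: "norm (complex_of_real (\<epsilon> n) *s e) = \<epsilon> n" using pos[of n] e by (simp add: norm_complex_scale)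
    have fd: "frechet_derivative f (at w) (of_real (\<epsilon> n) *s e) $ i = of_real (\<epsilon> n) * frechet_derivative f (at w) e $ i"
      unfolding holomorphic_map_on_frechet(2)[OF f wB] by simp
    have "cmod (f (w + of_real (\<epsilon> n) *s e) $ i - f w $ i - of_real (\<epsilon> n) * frechet_derivative f (at w) e $ i) \<le> C * (\<epsilon> n)\<^sup>2"
      using C[OF wr, of "of_real (\<epsilon> n) *s e"] le[of n] unfolding nv fd by simp
    moreover have "(f (w + of_real (\<epsilon> n) *s e) $ i - f w $ i) / of_real (\<epsilon> n) - frechet_derivative f (at w) e $ i
      = (f (w + of_real (\<epsilon> n) *s e) $ i - f w $ i - of_real (\<epsilon> n) * frechet_derivative f (at w) e $ i) / of_real (\<epsilon> n)"
      using pos[of n] by (simp add: diff_divide_distrib)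
    ultimately show ?thesis using pos[of n]
      by (simp add: norm_divide divide_le_eq power2_eq_square mult.assoc)
  qed
  have "uniform_limit (cball 0 r) (\<lambda>n w. (f (w + of_real (\<epsilon> n) *s e) $ i - f w $ i) / of_real (\<epsilon> n))
       (\<lambda>w. frechet_derivative f (at w) e $ i) sequentially"
  proof (rule uniform_limitI)
    fix d :: real assume "d > 0"
    with lim have "\<forall>\<^sub>F n in sequentially. C * \<epsilon> n < d" by (rule order_tendstoD)
    then show "\<forall>\<^sub>F n in sequentially. \<forall>w\<in>cball 0 r.
      dist ((f (w + of_real (\<epsilon> n) *s e) $ i - f w $ i) / of_real (\<epsilon> n)) (frechet_derivative f (at w) e $ i) < d"
    proof eventually_elim
      case (elim n)
      show ?case unfolding dist_norm by (intro ballI le_less_trans[OF bd elim])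
    qed
  qed
  moreover have "r + \<epsilon> n < 1" for n using le[of n] \<rho>(2) by simp
  ultimately show ?thesis using that[of \<epsilon>] pos by simp
qed

lemma directional_derivative_continuous_on:
  fixes f :: "complex^2 \<Rightarrow> complex^2"
  assumes f: "holomorphic_map_on f \<B>\<^sup>2" and e: "norm e = 1"
  shows "continuous_on \<B>\<^sup>2 (\<lambda>w. frechet_derivative f (at w) e $ i)"
proof (intro continuous_at_imp_continuous_on ballI)
  fix w assume "w \<in> \<B>\<^sup>2"
  then obtain r where r: "norm w < r" "r < 1" using dense[of "norm w" 1] by auto
  obtain \<epsilon> :: "nat \<Rightarrow> real" where \<epsilon>: "\<And>n. 0 < \<epsilon> n" "\<And>n. r + \<epsilon> n < 1"
    and ul: "uniform_limit (cball 0 r) (\<lambda>n w. (f (w + of_real (\<epsilon> n) *s e) $ i - f w $ i) / of_real (\<epsilon> n))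
       (\<lambda>w. frechet_derivative f (at w) e $ i) sequentially"
    by (rule directional_derivative_uniform_limit[OF f r(2) e, of i]) (rule that)
  have sub: "w + of_real (\<epsilon> n) *s e \<in> \<B>\<^sup>2" if "w \<in> cball 0 r" for w n
    using norm_triangle_ineq[of w "of_real (\<epsilon> n) *s e"] that \<epsilon>(1)[of n] \<epsilon>(2)[of n] e
    by (simp add: norm_complex_scale)
  have "continuous_on (cball 0 r) (\<lambda>w. frechet_derivative f (at w) e $ i)"
  proof (rule uniform_limit_theorem[OF _ ul])
    have "continuous_on (cball 0 r) (\<lambda>w. (f (w + of_real (\<epsilon> n) *s e) $ i - f w $ i) / of_real (\<epsilon> n))" for n
    proof -
      have 1: "continuous_on (cball 0 r) (\<lambda>w. f (w + of_real (\<epsilon> n) *s e))"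
        using sub by (intro continuous_on_compose2[OF holomorphic_map_on_imp_continuous_on[OF f]] continuous_intros) auto
      have 2: "continuous_on (cball 0 r) f"
        by (rule continuous_on_subset[OF holomorphic_map_on_imp_continuous_on[OF f]]) (use r in auto)
      show ?thesis using 1 2 \<epsilon>(1)[of n] by (intro continuous_intros) auto
    qed
    then show "\<forall>\<^sub>F n in sequentially. continuous_on (cball 0 r) (\<lambda>w. (f (w + of_real (\<epsilon> n) *s e) $ i - f w $ i) / of_real (\<epsilon> n))"
      by simp
  qed simp
  then show "isCont (\<lambda>w. frechet_derivative f (at w) e $ i) w"
    by (rule continuous_on_interior) (use r in simp)
qed

lemma directional_derivative_holomorphic_along_curve:
  fixes f :: "complex^2 \<Rightarrow> complex^2"
  assumes f: "holomorphic_map_on f \<B>\<^sup>2" and e: "norm e = 1"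
    and S: "open S" "g ` S \<subseteq> \<B>\<^sup>2" "\<And>i. (\<lambda>z. g z $ i) holomorphic_on S"
  shows "(\<lambda>z. frechet_derivative f (at (g z)) e $ i) holomorphic_on S"
proof -
  let ?P = "\<lambda>z. frechet_derivative f (at (g z)) e $ i"
  have cg: "continuous_on S g"
    unfolding continuous_on_def
    using S(3) holomorphic_on_imp_continuous_on unfolding continuous_on_def by (blast intro: vec_tendstoI)
  have "\<exists>D. (?P has_field_derivative D) (at z)" if z: "z \<in> S" for z
  proof -
    from z S(2) have "g z \<in> \<B>\<^sup>2" by blast
    then obtain r where r: "norm (g z) < r" "r < 1" using dense[of "norm (g z)" 1] by auto
    define T where "T = S \<inter> g -` ball 0 r"
    have T: "open T" "z \<in> T" unfolding T_def
      using continuous_open_preimage[OF cg S(1) open_ball] z r by auto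
    have gT: "norm (g w) < r" if "w \<in> T" for w using that by (auto simp: T_def)
    obtain \<epsilon> :: "nat \<Rightarrow> real" where \<epsilon>: "\<And>n. 0 < \<epsilon> n" "\<And>n. r + \<epsilon> n < 1"
      and ul: "uniform_limit (cball 0 r) (\<lambda>n w. (f (w + of_real (\<epsilon> n) *s e) $ i - f w $ i) / of_real (\<epsilon> n))
         (\<lambda>w. frechet_derivative f (at w) e $ i) sequentially"
    by (rule directional_derivative_uniform_limit[OF f r(2) e, of i]) (rule that)
    have sub: "g w + of_real (\<epsilon> n) *s e \<in> \<B>\<^sup>2" if "w \<in> T" for w n
      using norm_triangle_ineq[of "g w" "of_real (\<epsilon> n) *s e"] gT[OF that] \<epsilon>(1)[of n] \<epsilon>(2)[of n] e
      by (simp add: norm_complex_scale)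
    have "?P holomorphic_on T"
    proof (rule holomorphic_uniform_sequence[OF T(1)])
      fix n
      have gh: "(\<lambda>z. g z $ j) holomorphic_on T" for j
        by (rule holomorphic_on_subset[OF S(3)]) (simp add: T_def)
      have "(\<lambda>z. f (g z + of_real (\<epsilon> n) *s e) $ i) holomorphic_on T"
        by (rule holomorphic_on_curveI[OF f T(1)]) (use sub gh in \<open>auto intro!: holomorphic_intros\<close>)
      moreover have "(\<lambda>z. f (g z) $ i) holomorphic_on T"
      proof (rule holomorphic_on_curveI[OF f T(1) _ gh])
        show "g ` T \<subseteq> \<B>\<^sup>2" using S(2) by (auto simp: T_def)
      qed
      ultimately show "(\<lambda>z. (f (g z + of_real (\<epsilon> n) *s e) $ i - f (g z) $ i) / of_real (\<epsilon> n)) holomorphic_on T"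
        using \<epsilon>(1)[of n] by (intro holomorphic_intros) auto
    next
      fix w assume "w \<in> T"
      then obtain d where d: "d > 0" "cball w d \<subseteq> T" using T(1) open_contains_cball by blast
      have "uniform_limit (cball w d) (\<lambda>n z. (f (g z + of_real (\<epsilon> n) *s e) $ i - f (g z) $ i) / of_real (\<epsilon> n)) ?P sequentially"
      proof (rule uniform_limitI)
        fix x :: real assume "x > 0"
        from uniform_limitD[OF ul this]
        show "\<forall>\<^sub>F n in sequentially. \<forall>z\<in>cball w d. dist ((f (g z + of_real (\<epsilon> n) *s e) $ i - f (g z) $ i) / of_real (\<epsilon> n)) (?P z) < x"
        proof eventually_elim
          case (elim n)
          show ?case
          proof
            fix z assume "z \<in> cball w d"
            then have "norm (g z) < r" using gT d(2) by blast
            then have "g z \<in> cball 0 r" by simp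
            then show "dist ((f (g z + of_real (\<epsilon> n) *s e) $ i - f (g z) $ i) / of_real (\<epsilon> n)) (?P z) < x"
              using elim by blast
          qed
        qed
      qed
      then show "\<exists>d>0. cball w d \<subseteq> T \<and> uniform_limit (cball w d) (\<lambda>n z. (f (g z + of_real (\<epsilon> n) *s e) $ i - f (g z) $ i) / of_real (\<epsilon> n)) ?P sequentially"
        using d by blast
    qed
    then show ?thesis using T holomorphic_on_imp_differentiable_at field_differentiable_def by blast
  qed
  then show ?thesis by (simp add: holomorphic_on_open S(1))
qed

section \<open>The coefficient of the second variable squared\<close>

text \<open>The coefficient of \<open>z\<^sub>2\<^sup>2\<close> in the first component, read off on the slice \<open>z\<^sub>1 = 0\<close>.\<close>

definition quad_coeff :: "(complex^2 \<Rightarrow> complex^2) \<Rightarrow> complex"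
  where "quad_coeff f = (deriv ^^ 2) (\<lambda>z. f (vector [0, z]) $ 1) 0 / 2"

lemma norm_vector2: "norm (vector [x, y] :: complex^2) = sqrt ((cmod x)\<^sup>2 + (cmod y)\<^sup>2)"
  by (simp add: norm_vec_def L2_set_def sum_2)

lemma vector2_eta: "vector [w $ 1, w $ 2] = (w :: complex^2)"
  by (simp add: vec_eq_iff forall_2)

lemma slice_holomorphic:
  assumes "holomorphic_map_on f \<B>\<^sup>2"
  shows "(\<lambda>z. f (vector [0, z]) $ i) holomorphic_on ball 0 1"
proof (rule holomorphic_on_curveI[OF assms open_ball])
  show "(\<lambda>z. (vector [0, z] :: complex^2) $ i) holomorphic_on ball 0 1" for i
    using exhaust_2[of i] by (auto intro!: holomorphic_intros)
qed (auto simp: norm_vector2)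

lemma quad_coeff_tendsto:
  assumes f: "holomorphic_map_on f \<B>\<^sup>2" "f 0 = 0" "(f has_derivative (\<lambda>h. \<tau> *\<^sub>R h)) (at 0)"
  shows "((\<lambda>z. f (vector [0, z]) $ 1 / z\<^sup>2) \<longlongrightarrow> quad_coeff f) (at 0)"
  unfolding quad_coeff_def
proof (rule quadratic_coefficient[OF slice_holomorphic[OF f(1)]])
  have v0: "vector [0, 0] = (0 :: complex^2)" by (simp add: vec_eq_iff forall_2)
  then show "f (vector [0, 0]) $ 1 = 0" using f(2) by simp
  have "((\<lambda>z. vector [0, z] :: complex^2) has_derivative (\<lambda>h. h *s vector [0, 1])) (at 0)"
  proof (rule curve_has_derivative)
    show "((\<lambda>z. (vector [0, z] :: complex^2) $ i) has_field_derivative vector [0, 1] $ i) (at 0)" for i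
      using exhaust_2[of i] by (auto intro!: derivative_eq_intros)
  qed
  from curve_derivative_component[OF holomorphic_map_along_curve[OF f(1) _ this], of 1]
  have "((\<lambda>z. f (vector [0, z]) $ 1) has_field_derivative frechet_derivative f (at 0) (vector [0, 1]) $ 1) (at 0)"
    by (simp add: v0)
  also have "frechet_derivative f (at 0) = (\<lambda>h. \<tau> *\<^sub>R h)" using frechet_derivative_at[OF f(3)] by simp
  finally show "deriv (\<lambda>z. f (vector [0, z]) $ 1) 0 = 0" by (simp add: DERIV_imp_deriv)
qed

lemma quad_coeff_bound:
  assumes f: "holomorphic_map_on f \<B>\<^sup>2" and M: "\<And>z. norm z \<le> 1/2 \<Longrightarrow> norm (f z) \<le> M"
  shows "cmod (quad_coeff f) \<le> 4 * (M + 1)"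
proof -
  let ?p = "\<lambda>z. f (vector [0, z]) $ 1"
  have "cmod ((deriv ^^ 2) ?p 0) \<le> fact 2 * (M + 1) / (1/2) ^ 2"
  proof (rule Cauchy_higher_deriv_bound)
    show "?p holomorphic_on ball 0 (1/2)"
      by (rule holomorphic_on_subset[OF slice_holomorphic[OF f]]) auto
    show "continuous_on (cball 0 (1/2)) ?p"
      by (rule continuous_on_subset[OF holomorphic_on_imp_continuous_on[OF slice_holomorphic[OF f]]]) auto
    fix w :: complex assume "w \<in> ball 0 (1/2)"
    then have "norm (f (vector [0, w])) \<le> M" by (intro M) (simp add: norm_vector2)
    then have "cmod (?p w) \<le> M" by (rule order_trans[OF Finite_Cartesian_Product.norm_nth_le])
    then show "?p w \<in> ball 0 (M + 1)" by simp
  qed auto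
  then show ?thesis by (simp add: quad_coeff_def norm_divide power2_eq_square)
qed

text \<open>Subtracting the slice \<open>w\<^sub>1 = 0\<close> leaves a multiple of \<open>w\<^sub>1\<close> whose cofactor tends to the
  partial derivative at the origin. On discs with \<open>w\<^sub>1 = O(\<zeta>\<^sup>2)\<close> and \<open>w\<^sub>2 = O(\<zeta>)\<close> the two
  summands are exactly the contributions of order \<open>\<zeta>\<^sup>2\<close>: mixed terms are of higher order.\<close>

lemma first_component_factor:
  fixes f :: "complex^2 \<Rightarrow> complex^2"
  assumes f: "holomorphic_map_on f \<B>\<^sup>2" "(f has_derivative (\<lambda>h. \<tau> *\<^sub>R h)) (at 0)"
  obtains R where "isCont R 0" "R 0 = of_real \<tau>"
    "\<And>w. f w $ 1 = w $ 1 * R w + f (vector [0, w $ 2]) $ 1"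
proof -
  define P where "P = (\<lambda>w. frechet_derivative f (at w) (axis 1 1) $ 1)"
  define R where "R = (\<lambda>w. if w $ 1 = 0 then P (vector [0, w $ 2])
     else (f w $ 1 - f (vector [0, w $ 2]) $ 1) / w $ 1)"
  have ax: "norm (axis 1 1 :: complex^2) = 1" by (simp add: norm_vec_def L2_set_def sum_2 axis_def)
  have v0: "vector [0, 0] = (0 :: complex^2)" by (simp add: vec_eq_iff forall_2)
  have P0: "P 0 = of_real \<tau>"
    unfolding P_def frechet_derivative_at[OF f(2), symmetric] by (simp only: vector_scaleR_component) (simp add: axis_def scaleR_conv_of_real)
  have cP: "continuous_on \<B>\<^sup>2 P" unfolding P_def by (rule directional_derivative_continuous_on[OF f(1) ax])
  have vt: "((\<lambda>w. vector [0, w $ 2] :: complex^2) \<longlongrightarrow> 0) (at (0 :: complex^2))"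
  proof (rule vec_tendstoI)
    show "((\<lambda>w. (vector [0, w $ 2] :: complex^2) $ i) \<longlongrightarrow> (0 :: complex^2) $ i) (at (0 :: complex^2))" for i
      using exhaust_2[of i] tendsto_vec_nth[OF tendsto_ident_at[of "0 :: complex^2" UNIV], of 2] by auto
  qed
  have "isCont P 0" using cP by (simp add: continuous_on_eq_continuous_at)
  from isCont_tendsto_compose[OF this vt]
  have Plim: "((\<lambda>w::complex^2. P (vector [0, w $ 2])) \<longlongrightarrow> P 0) (at 0)" .
  have half: "1/2 < (1::real)" by simp
  obtain C \<rho> where \<rho>: "\<rho> > 0" "1/2 + \<rho> < 1"
    and C: "\<And>w v. norm w \<le> 1/2 \<Longrightarrow> norm v \<le> \<rho> \<Longrightarrow>
       cmod (f (w + v) $ 1 - f w $ 1 - frechet_derivative f (at w) v $ 1) \<le> C * (norm v)\<^sup>2"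
    by (rule holomorphic_map_second_order[OF f(1) half, of 1]) (rule that)
  have bd: "cmod (R w - P (vector [0, w $ 2])) \<le> \<bar>C\<bar> * cmod (w $ 1)"
    if "norm w \<le> 1/2" "norm w \<le> \<rho>" for w
  proof (cases "w $ 1 = 0")
    case False
    let ?w = "vector [0, w $ 2] :: complex^2"
    have nw: "norm ?w \<le> 1/2" using that(1) Finite_Cartesian_Product.norm_nth_le[of w 2] by (simp add: norm_vector2)
    have n1: "norm (w $ 1 *s axis 1 1 :: complex^2) = cmod (w $ 1)" using ax by (simp add: norm_complex_scale)
    have wd: "?w + w $ 1 *s axis 1 1 = w" by (simp add: vec_eq_iff forall_2 axis_def)
    have "?w \<in> \<B>\<^sup>2" using nw by simp
    then have fd: "frechet_derivative f (at ?w) (w $ 1 *s axis 1 1) $ 1 = w $ 1 * P ?w"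
      by (simp add: P_def holomorphic_map_on_frechet(2)[OF f(1)])
    have "cmod (f w $ 1 - f ?w $ 1 - w $ 1 * P ?w) \<le> C * (cmod (w $ 1))\<^sup>2"
      using C[OF nw, of "w $ 1 *s axis 1 1"] that(2) Finite_Cartesian_Product.norm_nth_le[of w 1] unfolding n1 wd fd by simp
    also have "\<dots> \<le> \<bar>C\<bar> * (cmod (w $ 1))\<^sup>2" by (simp add: mult_right_mono)
    finally have le: "cmod (f w $ 1 - f ?w $ 1 - w $ 1 * P ?w) \<le> \<bar>C\<bar> * (cmod (w $ 1))\<^sup>2" .
    have "R w - P ?w = (f w $ 1 - f ?w $ 1 - w $ 1 * P ?w) / w $ 1"
      using False by (simp add: R_def diff_divide_distrib)
    then show ?thesis using le False by (simp add: norm_divide divide_le_eq power2_eq_square mult.assoc)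
  qed (simp add: R_def)
  have "((\<lambda>w. R w - P (vector [0, w $ 2])) \<longlongrightarrow> 0) (at 0)"
  proof (rule Lim_null_comparison)
    show "\<forall>\<^sub>F w in at 0. cmod (R w - P (vector [0, w $ 2])) \<le> \<bar>C\<bar> * cmod (w $ 1)"
      unfolding eventually_at
    proof (intro exI conjI ballI impI)
      show "0 < min (1/2) \<rho>" using \<rho> by simp
      fix w :: "complex^2" assume "w \<noteq> 0 \<and> dist w 0 < min (1/2) \<rho>"
      then show "cmod (R w - P (vector [0, w $ 2])) \<le> \<bar>C\<bar> * cmod (w $ 1)"
        by (intro bd) auto
    qed
    show "((\<lambda>w. \<bar>C\<bar> * cmod (w $ 1)) \<longlongrightarrow> 0) (at (0 :: complex^2))"
      by (auto intro!: tendsto_eq_intros)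
  qed
  from tendsto_add[OF this Plim] have "(R \<longlongrightarrow> P 0) (at 0)" by simp
  moreover have R0: "R 0 = P 0" by (simp add: R_def v0)
  ultimately have cR: "isCont R 0" by (simp add: isCont_def)
  have fac: "f w $ 1 = w $ 1 * R w + f (vector [0, w $ 2]) $ 1" for w
  proof (cases "w $ 1 = 0")
    case True
    then have "vector [0, w $ 2] = w" using vector2_eta[of w] by simp
    then show ?thesis using True by simp
  qed (simp add: R_def)
  show ?thesis by (rule that[OF cR _ fac]) (simp only: R0 P0)
qed

lemma slice_along_curve_tendsto:
  assumes a: "((\<lambda>z. f (vector [0, z]) $ 1 / z\<^sup>2) \<longlongrightarrow> a) (at 0)" and f0: "f 0 = 0"
    and g: "((\<lambda>z. g z / z) \<longlongrightarrow> \<beta>) (at (0::complex))"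
  shows "((\<lambda>z. f (vector [0, g z] :: complex^2) $ 1 / z\<^sup>2) \<longlongrightarrow> a * \<beta>\<^sup>2) (at (0::complex))"
proof -
  define q where "q = (\<lambda>z. if z = 0 then a else f (vector [0, z]) $ 1 / z\<^sup>2)"
  have v0: "vector [0, 0] = (0 :: complex^2)" by (simp add: vec_eq_iff forall_2)
  have "(q \<longlongrightarrow> a) (at 0)"
    by (rule Lim_transform_eventually[OF a]) (auto simp: q_def eventually_at_filter)
  then have "isCont q 0" by (simp add: isCont_def q_def)
  moreover have "((\<lambda>z. g z / z * z) \<longlongrightarrow> \<beta> * 0) (at 0)" by (intro tendsto_mult g tendsto_ident_at)
  then have "(g \<longlongrightarrow> \<beta> * 0) (at 0)"
    by (rule Lim_transform_eventually) (auto simp: eventually_at_filter)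
  then have "(g \<longlongrightarrow> 0) (at 0)" by simp
  ultimately have "((\<lambda>z. q (g z)) \<longlongrightarrow> q 0) (at 0)" by (rule isCont_tendsto_compose)
  then have "((\<lambda>z. q (g z) * (g z / z)\<^sup>2) \<longlongrightarrow> a * \<beta>\<^sup>2) (at 0)"
    by (intro tendsto_mult tendsto_power g) (simp add: q_def)
  moreover have "q (g z) * (g z / z)\<^sup>2 = f (vector [0, g z]) $ 1 / z\<^sup>2" for z
    by (cases "g z = 0") (auto simp: q_def v0 f0 power_divide)
  ultimately show ?thesis by simp
qed

section \<open>Transition maps between univalent images\<close>

lemma frechet_derivative_eq_matrix:
  fixes f :: "complex^2 \<Rightarrow> complex^2"
  assumes f: "holomorphic_map_on f U" and z: "z \<in> U"
  shows "frechet_derivative f (at z) h = matrix (frechet_derivative f (at z)) *v h"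
proof -
  let ?D = "frechet_derivative f (at z)"
  have lin: "linear ?D" by (rule has_derivative_linear[OF holomorphic_map_on_frechet(1)[OF f z]])
  have "h = h $ 1 *s axis 1 1 + h $ 2 *s axis 2 1"
    by (simp add: vec_eq_iff forall_2 axis_def)
  then have "?D h = h $ 1 *s ?D (axis 1 1) + h $ 2 *s ?D (axis 2 1)"
    by (metis linear_add[OF lin] holomorphic_map_on_frechet(2)[OF f z])
  also have "\<dots> = matrix ?D *v h"
    by (simp add: vec_eq_iff forall_2 matrix_def matrix_vector_mult_def sum_2 mult.commute)
  finally show ?thesis .
qed

lemma univalent_inverse:
  fixes f :: "complex^2 \<Rightarrow> complex^2"
  assumes f: "univalent_on f \<B>\<^sup>2"
  shows "open (f ` \<B>\<^sup>2)" "continuous_on (f ` \<B>\<^sup>2) (inv_into \<B>\<^sup>2 f)"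
proof -
  have c: "continuous_on \<B>\<^sup>2 f" and inj: "inj_on f \<B>\<^sup>2"
    using f holomorphic_map_on_imp_continuous_on by (auto simp: univalent_on_def)
  show "open (f ` \<B>\<^sup>2)" by (rule invariance_of_domain[OF c open_ball inj])
  show "continuous_on (f ` \<B>\<^sup>2) (inv_into \<B>\<^sup>2 f)"
    by (rule continuous_on_inverse_open[OF open_ball c])
      (use inj in \<open>auto simp: inv_into_f_f\<close>)
qed

text \<open>At a point with nonzero Jacobian determinant, differentiability of \<open>f\<close> at that single point and
  continuity of the inverse already make the inverse differentiable, with a complex linear
  derivative.\<close>

lemma univalent_inverse_along_curve:
  fixes f :: "complex^2 \<Rightarrow> complex^2"
  assumes f: "univalent_on f \<B>\<^sup>2" and k: "k \<zeta> \<in> f ` \<B>\<^sup>2"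
    and kd: "(k has_derivative (\<lambda>h. h *s v)) (at \<zeta>)"
    and J: "det (matrix (frechet_derivative f (at (inv_into \<B>\<^sup>2 f (k \<zeta>))))) \<noteq> 0"
  shows "\<exists>v'. ((\<lambda>\<zeta>. inv_into \<B>\<^sup>2 f (k \<zeta>)) has_derivative (\<lambda>h. h *s v')) (at \<zeta>)"
proof -
  let ?g = "inv_into \<B>\<^sup>2 f"
  let ?w = "?g (k \<zeta>)"
  let ?A = "matrix (frechet_derivative f (at ?w))"
  have hol: "holomorphic_map_on f \<B>\<^sup>2" using f by (simp add: univalent_on_def)
  have w: "?w \<in> \<B>\<^sup>2" using k by (rule inv_into_into)
  obtain B where B: "B ** ?A = mat 1" using J invertible_det_nz[of ?A] unfolding invertible_def by blast
  have "(?g has_derivative (\<lambda>h. B *v h)) (at (k \<zeta>))"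
  proof (rule has_derivative_inverse_basic[where g = ?g and y = "k \<zeta>", OF holomorphic_map_on_frechet(1)[OF hol w] _ _ _ univalent_inverse(1)[OF f] k])
    show "bounded_linear (\<lambda>h. B *v h)" by (simp flip: linear_conv_bounded_linear)
    show "(\<lambda>h. B *v h) \<circ> frechet_derivative f (at ?w) = id"
      by (simp add: fun_eq_iff frechet_derivative_eq_matrix[OF hol w] matrix_vector_mul_assoc B)
    show "isCont ?g (k \<zeta>)"
      using k continuous_on_eq_continuous_at[OF univalent_inverse(1)[OF f]] univalent_inverse(2)[OF f] by blast
    show "f (?g y) = y" if "y \<in> f ` \<B>\<^sup>2" for y using that by (rule f_inv_into_f)
  qed
  from has_derivative_compose[OF kd this]
  have "((\<lambda>\<zeta>. ?g (k \<zeta>)) has_derivative (\<lambda>h. h *s (B *v v))) (at \<zeta>)"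
    by (simp add: vector_scalar_commute)
  then show ?thesis by blast
qed

lemma norm_cnj_sum_le:
  "cmod (cnj a * b + cnj c * d) \<le> sqrt ((cmod a)\<^sup>2 + (cmod c)\<^sup>2) * sqrt ((cmod b)\<^sup>2 + (cmod d)\<^sup>2)"
proof -
  have "cmod (cnj a * b + cnj c * d) \<le> cmod a * cmod b + cmod c * cmod d"
    using norm_triangle_ineq[of "cnj a * b" "cnj c * d"] by (simp add: norm_mult)
  also have "\<dots> \<le> sqrt ((cmod a)\<^sup>2 + (cmod c)\<^sup>2) * sqrt ((cmod b)\<^sup>2 + (cmod d)\<^sup>2)"
  proof -
    have "0 \<le> (cmod a * cmod d - cmod c * cmod b)\<^sup>2" by simp
    then have "(cmod a * cmod b + cmod c * cmod d)\<^sup>2 \<le> ((cmod a)\<^sup>2 + (cmod c)\<^sup>2) * ((cmod b)\<^sup>2 + (cmod d)\<^sup>2)"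
      by (simp add: power2_eq_square algebra_simps)
    then show ?thesis by (simp add: real_le_rsqrt flip: real_sqrt_mult)
  qed
  finally show ?thesis .
qed

lemma curve_component_holomorphic_on:
  fixes g :: "complex \<Rightarrow> complex^'n"
  assumes "open S" "\<And>z. z \<in> S \<Longrightarrow> \<exists>v. (g has_derivative (\<lambda>h. h *s v)) (at z)"
  shows "(\<lambda>z. g z $ i) holomorphic_on S"
  unfolding holomorphic_on_open[OF assms(1)]
proof
  fix z assume "z \<in> S"
  then obtain v where "(g has_derivative (\<lambda>h. h *s v)) (at z)" using assms(2) by blast
  from curve_derivative_component[OF this, of i]
  show "\<exists>f'. ((\<lambda>z. g z $ i) has_field_derivative f') (at z)" by blast
qed

text \<open>With \<open>\<phi> = f\<^sup>-\<^sup>1 \<circ> k\<close>, the disc \<open>g(\<zeta>) = \<phi>(x \<zeta>\<^sup>2, y \<zeta>)\<close> stays in the ball, and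
  \<open>(g\<^sub>1 / \<zeta>\<^sup>2, g\<^sub>2 / \<zeta>)\<close> extends to \<open>\<zeta> = 0\<close> with the value \<open>(l x + b y\<^sup>2, l y)\<close>. On the unit
  circle this pair has norm below \<open>1\<close>, and the maximum principle carries the bound to the
  centre. The maximum principle is applied to the inner product \<open>W\<close> with the central value.\<close>

lemma transition_map_bound:
  fixes f k :: "complex^2 \<Rightarrow> complex^2"
  assumes f: "univalent_on f \<B>\<^sup>2" "f 0 = 0" "(f has_derivative (\<lambda>h. \<tau> *\<^sub>R h)) (at 0)"
    and k: "holomorphic_map_on k \<B>\<^sup>2" "k 0 = 0" "(k has_derivative (\<lambda>h. \<sigma> *\<^sub>R h)) (at 0)"
    and sub: "k ` \<B>\<^sup>2 \<subseteq> f ` \<B>\<^sup>2" and \<tau>: "\<tau> > 0"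
    and xy: "(cmod x)\<^sup>2 + (cmod y)\<^sup>2 < 1"
    and l: "l = \<sigma> / \<tau>" and b: "b = (quad_coeff k - of_real (l\<^sup>2) * quad_coeff f) / of_real \<tau>"
  shows "(cmod (of_real l * x + b * y\<^sup>2))\<^sup>2 + (l * cmod y)\<^sup>2 \<le> 1"
proof -
  have fh: "holomorphic_map_on f \<B>\<^sup>2" and inj: "inj_on f \<B>\<^sup>2" using f(1) by (auto simp: univalent_on_def)
  define d :: "complex \<Rightarrow> complex^2" where "d = (\<lambda>\<zeta>. vector [x * \<zeta>\<^sup>2, y * \<zeta>])"
  define g where "g = (\<lambda>\<zeta>. inv_into \<B>\<^sup>2 f (k (d \<zeta>)))"
  have dB: "d \<zeta> \<in> \<B>\<^sup>2" if "cmod \<zeta> \<le> 1" for \<zeta>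
  proof -
    have "(cmod x * (cmod \<zeta>)\<^sup>2)\<^sup>2 \<le> (cmod x)\<^sup>2"
      using that by (intro power_mono mult_right_le_one_le power_le_one) auto
    moreover have "(cmod y * cmod \<zeta>)\<^sup>2 \<le> (cmod y)\<^sup>2"
      using that by (intro power_mono mult_right_le_one_le) auto
    ultimately have "(cmod x * (cmod \<zeta>)\<^sup>2)\<^sup>2 + (cmod y * cmod \<zeta>)\<^sup>2 < 1" using xy by linarith
    then show ?thesis by (simp add: d_def norm_vector2 norm_mult norm_power)
  qed
  have d0: "d 0 = 0" by (simp add: d_def vec_eq_iff forall_2)
  have dd: "(d has_derivative (\<lambda>h. h *s vector [2 * x * \<zeta>, y])) (at \<zeta>)" for \<zeta>
  proof (rule curve_has_derivative)
    show "((\<lambda>z. d z $ i) has_field_derivative vector [2 * x * \<zeta>, y] $ i) (at \<zeta>)" for i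
      using exhaust_2[of i] unfolding d_def by (auto intro!: derivative_eq_intros)
  qed
  have dcont: "continuous_on A d" for A
    by (intro continuous_at_imp_continuous_on ballI has_derivative_continuous[OF dd])
  have kB: "k (d \<zeta>) \<in> f ` \<B>\<^sup>2" if "cmod \<zeta> \<le> 1" for \<zeta> using dB[OF that] sub by blast
  have gB: "g \<zeta> \<in> \<B>\<^sup>2" if "cmod \<zeta> \<le> 1" for \<zeta> unfolding g_def by (rule inv_into_into[OF kB[OF that]])
  have fg: "f (g \<zeta>) = k (d \<zeta>)" if "cmod \<zeta> \<le> 1" for \<zeta> unfolding g_def by (rule f_inv_into_f[OF kB[OF that]])
  have g0: "g 0 = 0"
    using inv_into_f_f[OF inj, of 0] f(2) by (simp add: g_def d0 k(2))
  have gcont: "continuous_on (cball 0 1) g" unfolding g_def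
  proof (rule continuous_on_compose2[OF univalent_inverse(2)[OF f(1)]])
    show "continuous_on (cball 0 1) (\<lambda>\<zeta>. k (d \<zeta>))"
      using dB by (intro continuous_on_compose2[OF holomorphic_map_on_imp_continuous_on[OF k(1)] dcont]) auto
  qed (use kB in auto)
  \<comment> \<open>The Jacobian determinant of \<open>f\<close> along \<open>g\<close>, the auxiliary function of the maximum
    principle; \<open>g\<close> is known to be holomorphic where \<open>h\<close> does not vanish.\<close>
  define P where "P = (\<lambda>i j w. frechet_derivative f (at w) (axis j 1) $ i)"
  define h where "h = (\<lambda>\<zeta>. det (matrix (frechet_derivative f (at (g \<zeta>)))))"
  have hP: "h \<zeta> = P 1 1 (g \<zeta>) * P 2 2 (g \<zeta>) - P 1 2 (g \<zeta>) * P 2 1 (g \<zeta>)" for \<zeta>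
    by (simp add: h_def P_def det_2 matrix_def)
  have ax: "norm (axis i 1 :: complex^2) = 1" for i
    using exhaust_2[of i] by (auto simp: norm_vec_def L2_set_def sum_2 axis_def)
  have Pc: "continuous_on (cball 0 1) (\<lambda>\<zeta>. P i j (g \<zeta>))" for i j
    unfolding P_def using gB
    by (intro continuous_on_compose2[OF directional_derivative_continuous_on[OF fh ax] gcont]) auto
  have hc: "continuous_on (cball 0 1) h" unfolding hP by (intro continuous_intros Pc)
  have fd0: "frechet_derivative f (at 0) = (\<lambda>h. \<tau> *\<^sub>R h)" using frechet_derivative_at[OF f(3)] by simp
  have h0: "h 0 \<noteq> 0"
    using \<tau> unfolding hP g0 P_def fd0 by (simp only: vector_scaleR_component) (simp add: axis_def)
  define S where "S = {z \<in> ball 0 1. h z \<noteq> 0}"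
  have "S = ball 0 1 \<inter> h -` (- {0})" by (auto simp: S_def)
  then have oS: "open S"
    using continuous_open_preimage[OF continuous_on_subset[OF hc ball_subset_cball] open_ball, of "- {0}"]
    by (simp add: open_Compl)
  have S1: "cmod \<zeta> \<le> 1" if "\<zeta> \<in> S" for \<zeta> using that by (simp add: S_def)
  have gd: "\<exists>v. (g has_derivative (\<lambda>h. h *s v)) (at \<zeta>)" if "\<zeta> \<in> S" for \<zeta>
    unfolding g_def
  proof (rule univalent_inverse_along_curve[OF f(1)])
    show "k (d \<zeta>) \<in> f ` \<B>\<^sup>2" by (rule kB[OF S1[OF that]])
    show "((\<lambda>\<zeta>. k (d \<zeta>)) has_derivative (\<lambda>h. h *s frechet_derivative k (at (d \<zeta>)) (vector [2 * x * \<zeta>, y]))) (at \<zeta>)"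
      by (rule holomorphic_map_along_curve[OF k(1) dB[OF S1[OF that]] dd])
    show "det (matrix (frechet_derivative f (at (inv_into \<B>\<^sup>2 f (k (d \<zeta>)))))) \<noteq> 0"
      using that by (simp add: S_def h_def g_def)
  qed
  have gh: "(\<lambda>z. g z $ i) holomorphic_on S" for i by (rule curve_component_holomorphic_on[OF oS gd])
  have gS: "g ` S \<subseteq> \<B>\<^sup>2" using gB S1 by blast
  have hh: "h holomorphic_on S" unfolding hP P_def
    by (intro holomorphic_intros directional_derivative_holomorphic_along_curve[OF fh ax oS gS gh])
  \<comment> \<open>Differentiating \<open>f \<circ> g = k \<circ> d\<close> at the origin determines the tangent vector of \<open>g\<close>.\<close>
  have "0 \<in> S" using h0 by (simp add: S_def)
  from gd[OF this] obtain v where v: "(g has_derivative (\<lambda>h. h *s v)) (at 0)" by blast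
  have "\<tau> *\<^sub>R v = \<sigma> *\<^sub>R vector [0, y]"
  proof -
    have "((\<lambda>\<zeta>. f (g \<zeta>)) has_derivative (\<lambda>h. h *s (\<tau> *\<^sub>R v))) (at 0)"
      using holomorphic_map_along_curve[OF fh _ v] by (simp add: g0 fd0)
    then have 1: "((\<lambda>\<zeta>. k (d \<zeta>)) has_derivative (\<lambda>h. h *s (\<tau> *\<^sub>R v))) (at 0)"
      by (rule has_derivative_transform_within_open[OF _ open_ball[of 0 1]]) (use fg in auto)
    have "frechet_derivative k (at 0) = (\<lambda>h. \<sigma> *\<^sub>R h)" using frechet_derivative_at[OF k(3)] by simp
    then have 2: "((\<lambda>\<zeta>. k (d \<zeta>)) has_derivative (\<lambda>h. h *s (\<sigma> *\<^sub>R vector [0, y]))) (at 0)"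
      using holomorphic_map_along_curve[OF k(1) _ dd[of 0]] by (simp add: d0)
    show ?thesis using fun_cong[OF has_derivative_unique[OF 1 2], of 1] by simp
  qed
  then have "\<tau> *\<^sub>R (v $ 2) = \<sigma> *\<^sub>R y" by (metis vector_scaleR_component vector_2(2))
  then have v2: "v $ 2 = of_real l * y" using \<tau> by (simp add: l scaleR_conv_of_real field_simps)
  have g2: "((\<lambda>\<zeta>. g \<zeta> $ 2 / \<zeta>) \<longlongrightarrow> of_real l * y) (at 0)"
    using curve_derivative_component[OF v, of 2] unfolding v2 has_field_derivative_iff by (simp add: g0)
  \<comment> \<open>Comparing the terms of order \<open>\<zeta>\<^sup>2\<close> in the first component of \<open>f \<circ> g = k \<circ> d\<close>, each side
    split as in \<open>first_component_factor\<close>, yields the limit of \<open>g\<^sub>1 / \<zeta>\<^sup>2\<close>.\<close>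
  have glim: "(g \<longlongrightarrow> 0) (at 0)" using has_derivative_continuous[OF v] by (simp add: isCont_def g0)
  have dlim: "(d \<longlongrightarrow> 0) (at 0)" using has_derivative_continuous[OF dd[of 0]] by (simp only: isCont_def d0)
  obtain Rf where Rf: "isCont Rf 0" "Rf 0 = of_real \<tau>"
    "\<And>w. f w $ 1 = w $ 1 * Rf w + f (vector [0, w $ 2]) $ 1"
    by (rule first_component_factor[OF fh f(3)]) (rule that)
  obtain Rk where Rk: "isCont Rk 0" "Rk 0 = of_real \<sigma>"
    "\<And>w. k w $ 1 = w $ 1 * Rk w + k (vector [0, w $ 2]) $ 1"
    by (rule first_component_factor[OF k(1,3)]) (rule that)
  have Rflim: "((\<lambda>\<zeta>. Rf (g \<zeta>)) \<longlongrightarrow> of_real \<tau>) (at 0)"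
    using isCont_tendsto_compose[OF Rf(1) glim] by (simp add: Rf(2))
  have Rklim: "((\<lambda>\<zeta>. Rk (d \<zeta>)) \<longlongrightarrow> of_real \<sigma>) (at 0)"
    using isCont_tendsto_compose[OF Rk(1) dlim] by (simp add: Rk(2))
  define \<alpha> where "\<alpha> = of_real l * x + b * y\<^sup>2"
  have "((\<lambda>\<zeta>. y * \<zeta> / \<zeta>) \<longlongrightarrow> y) (at (0::complex))"
    by (rule Lim_transform_eventually[OF tendsto_const]) (auto simp: eventually_at_filter)
  then have kl: "((\<lambda>\<zeta>. k (vector [0, y * \<zeta>]) $ 1 / \<zeta>\<^sup>2) \<longlongrightarrow> quad_coeff k * y\<^sup>2) (at 0)"
    by (rule slice_along_curve_tendsto[OF quad_coeff_tendsto[OF k] k(2)])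
  have fl: "((\<lambda>\<zeta>. f (vector [0, g \<zeta> $ 2]) $ 1 / \<zeta>\<^sup>2) \<longlongrightarrow> quad_coeff f * (of_real l * y)\<^sup>2) (at 0)"
    by (rule slice_along_curve_tendsto[OF quad_coeff_tendsto[OF fh f(2,3)] f(2) g2])
  have "((\<lambda>\<zeta>. (x * Rk (d \<zeta>) + k (vector [0, y * \<zeta>]) $ 1 / \<zeta>\<^sup>2 - f (vector [0, g \<zeta> $ 2]) $ 1 / \<zeta>\<^sup>2) / Rf (g \<zeta>))
      \<longlongrightarrow> (x * of_real \<sigma> + quad_coeff k * y\<^sup>2 - quad_coeff f * (of_real l * y)\<^sup>2) / of_real \<tau>) (at 0)"
    using \<tau> by (intro tendsto_intros kl fl Rflim Rklim) simp
  also have "(x * of_real \<sigma> + quad_coeff k * y\<^sup>2 - quad_coeff f * (of_real l * y)\<^sup>2) / of_real \<tau> = \<alpha>"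
    using \<tau> by (simp add: \<alpha>_def b l power_mult_distrib power_divide diff_divide_distrib add_divide_distrib algebra_simps)
  finally have lim: "((\<lambda>\<zeta>. (x * Rk (d \<zeta>) + k (vector [0, y * \<zeta>]) $ 1 / \<zeta>\<^sup>2 - f (vector [0, g \<zeta> $ 2]) $ 1 / \<zeta>\<^sup>2) / Rf (g \<zeta>))
      \<longlongrightarrow> \<alpha>) (at 0)" .
  have g1: "((\<lambda>\<zeta>. g \<zeta> $ 1 / \<zeta>\<^sup>2) \<longlongrightarrow> \<alpha>) (at 0)"
  proof (rule Lim_transform_eventually[OF lim])
    have "\<forall>\<^sub>F \<zeta> in at 0. Rf (g \<zeta>) \<noteq> 0"
      using tendsto_imp_eventually_ne[OF Rflim] \<tau> by simp
    moreover have "\<forall>\<^sub>F \<zeta> in at (0::complex). cmod \<zeta> \<le> 1 \<and> \<zeta> \<noteq> 0"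
      unfolding eventually_at by (intro exI[of _ 1]) auto
    ultimately show "\<forall>\<^sub>F \<zeta> in at 0. (x * Rk (d \<zeta>) + k (vector [0, y * \<zeta>]) $ 1 / \<zeta>\<^sup>2 - f (vector [0, g \<zeta> $ 2]) $ 1 / \<zeta>\<^sup>2) / Rf (g \<zeta>)
        = g \<zeta> $ 1 / \<zeta>\<^sup>2"
    proof eventually_elim
      case (elim \<zeta>)
      have "k (d \<zeta>) $ 1 = x * \<zeta>\<^sup>2 * Rk (d \<zeta>) + k (vector [0, y * \<zeta>]) $ 1"
        using Rk(3)[of "d \<zeta>"] by (simp add: d_def)
      moreover have "k (d \<zeta>) $ 1 = g \<zeta> $ 1 * Rf (g \<zeta>) + f (vector [0, g \<zeta> $ 2]) $ 1"
        using Rf(3)[of "g \<zeta>"] fg elim by simp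
      ultimately have "x * \<zeta>\<^sup>2 * Rk (d \<zeta>) + k (vector [0, y * \<zeta>]) $ 1 - f (vector [0, g \<zeta> $ 2]) $ 1 = g \<zeta> $ 1 * Rf (g \<zeta>)"
        by (metis add_diff_cancel_right')
      then show ?case using elim by (simp add: field_simps)
    qed
  qed
  \<comment> \<open>The value at the origin is the limit there, which removes the singularity.\<close>
  define W where "W = (\<lambda>\<zeta>. if \<zeta> = 0 then cnj \<alpha> * \<alpha> + cnj (of_real l * y) * (of_real l * y)
     else cnj \<alpha> * (g \<zeta> $ 1 / \<zeta>\<^sup>2) + cnj (of_real l * y) * (g \<zeta> $ 2 / \<zeta>))"
  have Wlim: "(W \<longlongrightarrow> W 0) (at 0)"
  proof (rule Lim_transform_eventually)
    show "((\<lambda>\<zeta>. cnj \<alpha> * (g \<zeta> $ 1 / \<zeta>\<^sup>2) + cnj (of_real l * y) * (g \<zeta> $ 2 / \<zeta>)) \<longlongrightarrow> W 0) (at 0)"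
      unfolding W_def by (simp only: if_True refl) (intro tendsto_intros g1 g2)
  qed (auto simp: W_def eventually_at_filter)
  have Wc: "continuous_on (cball 0 1) W"
    unfolding continuous_on_eq_continuous_within
  proof
    fix z :: complex assume z: "z \<in> cball 0 1"
    show "continuous (at z within cball 0 1) W"
    proof (cases "z = 0")
      case True
      then show ?thesis using Wlim by (simp add: continuous_within Lim_at_imp_Lim_at_within)
    next
      case False
      have "continuous_on (cball 0 1 - {0}) (\<lambda>\<zeta>. cnj \<alpha> * (g \<zeta> $ 1 / \<zeta>\<^sup>2) + cnj (of_real l * y) * (g \<zeta> $ 2 / \<zeta>))"
        by (intro continuous_intros continuous_on_subset[OF gcont]) auto
      then have "continuous_on (cball 0 1 - {0}) W"
        by (rule continuous_on_eq) (auto simp: W_def)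
      then have "continuous (at z within cball 0 1 - {0}) W"
        using z False by (simp add: continuous_on_eq_continuous_within)
      also have "at z within cball 0 1 - {0} = at z within cball 0 1"
        by (rule at_within_nhd[of z "- {0}"]) (use False in auto)
      finally show ?thesis .
    qed
  qed
  have Wh: "W holomorphic_on S"
  proof (rule no_isolated_singularity[OF _ _ oS, of _ "{0}"])
    show "continuous_on S W" by (rule continuous_on_subset[OF Wc]) (use S1 in auto)
    have "(\<lambda>\<zeta>. cnj \<alpha> * (g \<zeta> $ 1 / \<zeta>\<^sup>2) + cnj (of_real l * y) * (g \<zeta> $ 2 / \<zeta>)) holomorphic_on S - {0}"
      by (intro holomorphic_intros holomorphic_on_subset[OF gh]) auto
    then show "W holomorphic_on S - {0}"
      by (rule holomorphic_transform) (auto simp: W_def)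
  qed simp
  define N where "N = sqrt ((cmod \<alpha>)\<^sup>2 + (cmod (of_real l * y))\<^sup>2)"
  have "cmod (W 0) \<le> N"
  proof (rule maximum_modulus_off_zero_set[OF hc Wc _ _ h0])
    show "h holomorphic_on {z \<in> ball 0 1. h z \<noteq> 0}" "W holomorphic_on {z \<in> ball 0 1. h z \<noteq> 0}"
      using hh Wh by (simp_all add: S_def)
    fix z :: complex assume "z \<in> sphere 0 1"
    then have z: "cmod z = 1" by simp
    then have z0: "z \<noteq> 0" by auto
    have "cmod (W z) \<le> N * sqrt ((cmod (g z $ 1 / z\<^sup>2))\<^sup>2 + (cmod (g z $ 2 / z))\<^sup>2)"
      unfolding W_def N_def if_not_P[OF z0] by (rule norm_cnj_sum_le)
    also have "sqrt ((cmod (g z $ 1 / z\<^sup>2))\<^sup>2 + (cmod (g z $ 2 / z))\<^sup>2) = norm (g z)"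
      using z by (simp add: norm_divide norm_power norm_vec_def L2_set_def sum_2)
    also have "N * norm (g z) \<le> N * 1"
      using gB[of z] z by (intro mult_left_mono) (auto simp: N_def)
    finally show "cmod (W z) \<le> N" by simp
  qed
  moreover have "cnj a * a = of_real ((cmod a)\<^sup>2)" for a
    using complex_norm_square[of a] by (simp add: mult.commute)
  then have "W 0 = of_real (N\<^sup>2)"
    unfolding W_def if_P[OF refl] by (simp only: N_def) simp
  ultimately have "N\<^sup>2 \<le> N" by (simp add: norm_power)
  moreover have "N \<ge> 0" by (simp add: N_def)
  ultimately have "N \<le> 1" by (cases "N = 0") (simp_all add: power2_eq_square)
  then have "N\<^sup>2 \<le> 1" using \<open>N \<ge> 0\<close> by (simp add: power_le_one)
  then show ?thesis by (simp add: N_def \<alpha>_def norm_mult power_mult_distrib)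
qed

section \<open>The coefficient bound along normal Loewner chains\<close>

text \<open>The product \<open>x y\<^sup>2\<close> is maximal on the unit sphere at \<open>x = 1 / \<surd>3\<close>, \<open>y = \<surd>(2/3)\<close>. The
  hypothesis is tested at \<open>r\<close> times this point, with \<open>x\<close> rotated so that both summands have the
  same argument, and then \<open>r\<close> tends to \<open>1\<close>.\<close>

lemma shear_coefficient_bound:
  assumes l: "0 < l"
    and le: "\<And>x y. (cmod x)\<^sup>2 + (cmod y)\<^sup>2 < 1 \<Longrightarrow> (cmod (of_real l * x + b * y\<^sup>2))\<^sup>2 + (l * cmod y)\<^sup>2 \<le> 1"
  shows "l * cmod b \<le> 3 * sqrt 3 / 4 * (1 - l\<^sup>2)"
proof (cases "b = 0")
  case True
  have "l\<^sup>2 * r\<^sup>2 \<le> 1" if "0 < r" "r < 1" for r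
  proof -
    have "r\<^sup>2 < 1" using that by (simp add: power_less_one_iff)
    then show ?thesis using le[of 0 "of_real r"] True by (simp add: power_mult_distrib)
  qed
  then have ev: "\<forall>\<^sub>F r in at_left 1. l\<^sup>2 * r\<^sup>2 \<le> 1"
    unfolding eventually_at_left_field by (intro exI[of _ 0]) auto
  have lim: "((\<lambda>r. l\<^sup>2 * r\<^sup>2) \<longlongrightarrow> l\<^sup>2 * 1\<^sup>2) (at_left 1)" by (intro tendsto_intros)
  have "l\<^sup>2 * 1\<^sup>2 \<le> 1" by (rule tendsto_upperbound[OF lim ev]) simp
  then show ?thesis using True by simp
next
  case False
  define c where "c = 4 / (3 * sqrt 3) * l * cmod b"
  have "l\<^sup>2 * r\<^sup>2 + c * r ^ 3 \<le> 1" if r: "0 < r" "r < 1" for r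
  proof -
    define x where "x = of_real (r / sqrt 3) * sgn b"
    define y where "y = complex_of_real (r * sqrt (2/3))"
    have ns: "cmod (sgn b) = 1" using False by (simp add: norm_sgn)
    have x2: "(cmod x)\<^sup>2 = r\<^sup>2 / 3" by (simp add: x_def norm_mult ns power_divide norm_divide)
    have y2: "(cmod y)\<^sup>2 = r\<^sup>2 * 2 / 3" by (simp add: y_def norm_mult power_mult_distrib)
    have "r\<^sup>2 < 1" using r by (simp add: power_less_one_iff)
    then have "(cmod x)\<^sup>2 + (cmod y)\<^sup>2 < 1" by (simp add: x2 y2)
    from le[OF this] have 1: "(cmod (of_real l * x + b * y\<^sup>2))\<^sup>2 + (l * cmod y)\<^sup>2 \<le> 1" .
    have "y\<^sup>2 = of_real (r\<^sup>2 * 2 / 3)"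
      unfolding y_def by (simp only: of_real_power[symmetric] power_mult_distrib) simp
    moreover have "b = of_real (cmod b) * sgn b" by (simp add: sgn_eq)
    ultimately have "of_real l * x + b * y\<^sup>2 = of_real (l * r / sqrt 3 + cmod b * (r\<^sup>2 * 2 / 3)) * sgn b"
      by (metis (no_types, lifting) x_def mult.assoc mult.commute of_real_add of_real_mult distrib_right times_divide_eq_right)
    then have "cmod (of_real l * x + b * y\<^sup>2) = l * r / sqrt 3 + cmod b * (r\<^sup>2 * 2 / 3)"
      using l r by (simp only: norm_mult ns norm_of_real) simp
    with 1 have "(l * r / sqrt 3 + cmod b * (r\<^sup>2 * 2 / 3))\<^sup>2 + l\<^sup>2 * (r\<^sup>2 * 2 / 3) \<le> 1"
      by (simp add: power_mult_distrib y2)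
    moreover have "(l * r / sqrt 3 + cmod b * (r\<^sup>2 * 2 / 3))\<^sup>2
        = l\<^sup>2 * r\<^sup>2 / 3 + c * r ^ 3 + (cmod b * (r\<^sup>2 * 2 / 3))\<^sup>2"
      unfolding power2_sum by (simp add: c_def power_mult_distrib power_divide power2_eq_square power3_eq_cube mult_ac)
    moreover have "0 \<le> (cmod b * (r\<^sup>2 * 2 / 3))\<^sup>2" by simp
    ultimately show ?thesis by linarith
  qed
  then have ev: "\<forall>\<^sub>F r in at_left 1. l\<^sup>2 * r\<^sup>2 + c * r ^ 3 \<le> 1"
    unfolding eventually_at_left_field by (intro exI[of _ 0]) auto
  have lim: "((\<lambda>r. l\<^sup>2 * r\<^sup>2 + c * r ^ 3) \<longlongrightarrow> l\<^sup>2 * 1\<^sup>2 + c * 1 ^ 3) (at_left 1)" by (intro tendsto_intros)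
  have "l\<^sup>2 * 1\<^sup>2 + c * 1 ^ 3 \<le> 1" by (rule tendsto_upperbound[OF lim ev]) simp
  then have "c \<le> 1 - l\<^sup>2" by simp
  then have "3 * sqrt 3 / 4 * c \<le> 3 * sqrt 3 / 4 * (1 - l\<^sup>2)" by (intro mult_left_mono) auto
  moreover have "3 * sqrt 3 / 4 * c = l * cmod b" by (simp add: c_def)
  ultimately show ?thesis by (simp only:)
qed

text \<open>The factor \<open>e\<^sup>t\<^sup>-\<^sup>s (e\<^sup>t\<^sup>-\<^sup>s + 1)\<close> tends to \<open>2\<close> as \<open>t - s\<close> tends to \<open>0\<close>, and the difference of
  exponentials telescopes; the bound is arranged in this form so that it can be summed.\<close>

lemma Loewner_chain_step:
  assumes F: "normalized_Loewner_chain F" and st: "0 \<le> s" "s \<le> t"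
  shows "cmod (of_real (exp (-2 * s)) * quad_coeff (F s) - of_real (exp (-2*t)) * quad_coeff (F t))
    \<le> 3 * sqrt 3 / 4 * exp (t - s) * (exp (t - s) + 1) * (exp (-s) - exp (-t))"
proof -
  define l where "l = exp (s - t)"
  define b where "b = (quad_coeff (F s) - of_real (l\<^sup>2) * quad_coeff (F t)) / of_real (exp t)"
  have "l * cmod b \<le> 3 * sqrt 3 / 4 * (1 - l\<^sup>2)"
  proof (rule shear_coefficient_bound)
    fix x y :: complex assume xy: "(cmod x)\<^sup>2 + (cmod y)\<^sup>2 < 1"
    show "(cmod (of_real l * x + b * y\<^sup>2))\<^sup>2 + (l * cmod y)\<^sup>2 \<le> 1"
    proof (rule transition_map_bound[OF _ _ _ _ _ _ _ _ xy _ b_def])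
      show "univalent_on (F t) \<B>\<^sup>2" "F t 0 = 0" "(F t has_derivative (\<lambda>h. exp t *\<^sub>R h)) (at 0)"
        "holomorphic_map_on (F s) \<B>\<^sup>2" "F s 0 = 0" "(F s has_derivative (\<lambda>h. exp s *\<^sub>R h)) (at 0)"
        "F s ` \<B>\<^sup>2 \<subseteq> F t ` \<B>\<^sup>2"
        using F st by (auto simp: normalized_Loewner_chain_def univalent_on_def)
      show "l = exp s / exp t" by (simp add: l_def exp_diff)
    qed simp
  qed (simp add: l_def)
  then have "cmod b \<le> 3 * sqrt 3 / 4 * ((1 - l\<^sup>2) / l)" by (simp add: l_def field_simps)
  then have "exp (t - 2 * s) * cmod b \<le> exp (t - 2 * s) * (3 * sqrt 3 / 4 * ((1 - l\<^sup>2) / l))"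
    by (rule mult_left_mono) simp
  moreover have "of_real (exp (-2 * s)) * quad_coeff (F s) - of_real (exp (-2*t)) * quad_coeff (F t)
     = of_real (exp (t - 2 * s)) * b"
  proof -
    have e: "exp (t - 2 * s) / exp t = exp (-2 * s)" "exp (t - 2 * s) / exp t * l\<^sup>2 = exp (-2*t)"
      by (simp_all add: l_def exp_double[symmetric] algebra_simps flip: exp_diff exp_add)
    have "of_real (exp (t - 2 * s)) * b = of_real (exp (t - 2 * s) / exp t) * quad_coeff (F s)
       - of_real (exp (t - 2 * s) / exp t * l\<^sup>2) * quad_coeff (F t)"
      by (simp add: b_def algebra_simps diff_divide_distrib)
    then show ?thesis unfolding e(2) unfolding e(1) by simp
  qed
  then have "cmod (of_real (exp (-2 * s)) * quad_coeff (F s) - of_real (exp (-2 * t)) * quad_coeff (F t))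
      = exp (t - 2 * s) * cmod b" by (simp add: norm_mult)
  moreover have "exp (t - 2 * s) * ((1 - l\<^sup>2) / l) = exp (t - s) * (exp (t - s) + 1) * (exp (-s) - exp (-t))"
  proof -
    define p where "p = exp (t - s)"
    have p: "p > 0" "l = 1 / p" "exp (t - 2 * s) = p * exp (-s)" "exp (-t) = exp (-s) / p"
      by (simp_all add: p_def l_def exp_diff exp_minus field_simps flip: exp_add)
    show ?thesis unfolding p_def[symmetric] p(2-4) using p(1)
      by (simp add: field_simps power2_eq_square)
  qed
  ultimately show ?thesis by (simp only: mult.assoc mult.left_commute[of "exp (t - 2 * s)"])
qed

lemma Loewner_chain_telescope:
  assumes F: "normalized_Loewner_chain F" and h: "0 \<le> h"
  shows "cmod (quad_coeff (F 0) - of_real (exp (-2*(real n*h))) * quad_coeff (F (real n*h)))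
    \<le> 3 * sqrt 3 / 4 * exp h * (exp h + 1) * (1 - exp (-(real n*h)))"
proof (induction n)
  case (Suc n)
  let ?B = "\<lambda>t. of_real (exp (-2*t)) * quad_coeff (F t)"
  let ?t = "real n * h"
  have "cmod (?B ?t - ?B (?t + h)) \<le> 3 * sqrt 3 / 4 * exp (?t + h - ?t) * (exp (?t + h - ?t) + 1) * (exp (- ?t) - exp (-(?t + h)))"
    using h by (intro Loewner_chain_step[OF F]) auto
  then have "cmod (?B ?t - ?B (?t + h)) \<le> 3 * sqrt 3 / 4 * exp h * (exp h + 1) * (exp (- ?t) - exp (-(?t + h)))"
    by simp
  moreover have "cmod (quad_coeff (F 0) - ?B (?t + h)) \<le> cmod (quad_coeff (F 0) - ?B ?t) + cmod (?B ?t - ?B (?t + h))"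
    using norm_triangle_ineq[of "quad_coeff (F 0) - ?B ?t" "?B ?t - ?B (?t + h)"] by (simp only: diff_add_cancel add_diff_eq)
  moreover have "real (Suc n) * h = ?t + h" by (simp add: algebra_simps)
  ultimately show ?case using Suc by (simp add: algebra_simps)
qed simp

text \<open>Normality makes \<open>e\<^sup>-\<^sup>t f\<^sub>t\<close> uniformly bounded on the ball of radius \<open>1/2\<close> for a subsequence of
  the times \<open>n h\<close>. Cauchy's estimate then bounds \<open>e\<^sup>-\<^sup>t a\<^sub>t\<close>, and a further factor \<open>e\<^sup>-\<^sup>t\<close> tends
  to zero.\<close>

lemma normal_chain_quad_coeff_null:
  assumes F: "normal_Loewner_chain F" and h: "0 < h" and e: "0 < e"
  obtains n :: nat where "cmod (of_real (exp (-2*(real n*h))) * quad_coeff (F (real n*h))) < e"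
proof -
  have chain: "normalized_Loewner_chain F"
    and nf: "normal_family_on {(\<lambda>z. exp (- t) *\<^sub>R F t z) | t. 0 \<le> t} \<B>\<^sup>2"
    using F by (auto simp: normal_Loewner_chain_def)
  define \<phi> where "\<phi> = (\<lambda>n z. exp (-(real n*h)) *\<^sub>R F (real n*h) z)"
  have "range \<phi> \<subseteq> {(\<lambda>z. exp (- t) *\<^sub>R F t z) | t. 0 \<le> t}"
    using h by (auto simp: \<phi>_def)
  from nf[unfolded normal_family_on_def, rule_format, OF this] obtain r g where r: "strict_mono r"
    and ul: "\<forall>K. compact K \<and> K \<subseteq> \<B>\<^sup>2 \<longrightarrow> uniform_limit K (\<phi> \<circ> r) g sequentially"
    by blast
  let ?K = "cball 0 (1/2) :: (complex^2) set"
  have hol: "holomorphic_map_on (F t) \<B>\<^sup>2" if "0 \<le> t" for t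
    using chain that by (simp add: normalized_Loewner_chain_def univalent_on_def)
  have u: "uniform_limit ?K (\<phi> \<circ> r) g sequentially" by (rule ul[rule_format]) auto
  have "continuous_on ?K ((\<phi> \<circ> r) n)" for n
    using h unfolding \<phi>_def comp_def
    by (intro continuous_intros continuous_on_subset[OF holomorphic_map_on_imp_continuous_on[OF hol]]) auto
  then have "continuous_on ?K g"
    by (intro uniform_limit_theorem[OF _ u]) auto
  then obtain M where M: "\<And>z. z \<in> ?K \<Longrightarrow> norm (g z) \<le> M" "M \<ge> 0"
    using continuous_on_compact_bound[OF compact_cball] by metis
  have "(\<lambda>n. exp (-h) ^ n * (4 * (M + 2))) \<longlonglongrightarrow> 0 * (4 * (M + 2))"
    using h by (intro tendsto_mult LIMSEQ_power_zero tendsto_const) simp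
  then have "\<forall>\<^sub>F n in sequentially. exp (-h) ^ n * (4 * (M + 2)) < e"
    using e by (simp add: order_tendstoD)
  moreover have "\<forall>\<^sub>F n in sequentially. \<forall>z\<in>?K. dist ((\<phi> \<circ> r) n z) (g z) < 1"
    by (rule uniform_limitD[OF u]) simp
  ultimately have "\<forall>\<^sub>F n in sequentially. exp (-h) ^ n * (4 * (M + 2)) < e \<and> (\<forall>z\<in>?K. dist ((\<phi> \<circ> r) n z) (g z) < 1)"
    by (rule eventually_conj)
  then obtain n where n: "exp (-h) ^ n * (4 * (M + 2)) < e" "\<And>z. z \<in> ?K \<Longrightarrow> dist ((\<phi> \<circ> r) n z) (g z) < 1"
    using eventually_happens'[OF sequentially_bot] by blast
  define t where "t = real (r n) * h"
  have t: "0 \<le> t" using h by (simp add: t_def)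
  have "cmod (quad_coeff (F t)) \<le> 4 * (exp t * (M + 1) + 1)"
  proof (rule quad_coeff_bound[OF hol[OF t]])
    fix z :: "complex^2" assume "norm z \<le> 1/2"
    then have z: "z \<in> ?K" by simp
    have "norm (\<phi> (r n) z) \<le> norm (g z) + dist (\<phi> (r n) z) (g z)"
      by (metis add.commute dist_norm norm_triangle_sub)
    also have "\<dots> \<le> M + 1" using M(1)[OF z] n(2)[OF z] by simp
    finally have "exp (- t) * norm (F t z) \<le> M + 1" by (simp add: \<phi>_def t_def)
    then have "exp t * (exp (- t) * norm (F t z)) \<le> exp t * (M + 1)" by (rule mult_left_mono) simp
    then show "norm (F t z) \<le> exp t * (M + 1)" by (simp add: exp_minus field_simps)
  qed
  also have "\<dots> \<le> exp t * (4 * (M + 2))" using t by (simp add: algebra_simps)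
  finally have q: "cmod (quad_coeff (F t)) \<le> exp t * (4 * (M + 2))" .
  have "cmod (of_real (exp (-2*t)) * quad_coeff (F t)) \<le> exp (-2*t) * (exp t * (4 * (M + 2)))"
    unfolding norm_mult by (rule mult_mono) (use q in auto)
  also have "\<dots> = exp (-t) * (4 * (M + 2))"
    by (simp flip: exp_add mult.assoc)
  also have "\<dots> \<le> exp (-h) ^ n * (4 * (M + 2))"
  proof (rule mult_right_mono)
    have "real n * h \<le> t" unfolding t_def using seq_suble[OF r, of n] h by (intro mult_right_mono) auto
    then show "exp (-t) \<le> exp (-h) ^ n" by (simp flip: exp_of_nat_mult)
  qed (use M in simp)
  also note n(1)
  finally show ?thesis using that[of "r n"] by (simp add: t_def)
qed

lemma normal_chain_quad_coeff_bound:
  assumes F: "normal_Loewner_chain F"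
  shows "cmod (quad_coeff (F 0)) \<le> 3 * sqrt 3 / 2"
proof -
  let ?c = "3 * sqrt 3 / 4 :: real"
  have chain: "normalized_Loewner_chain F" using F by (simp add: normal_Loewner_chain_def)
  have *: "cmod (quad_coeff (F 0)) \<le> ?c * exp h * (exp h + 1)" if h: "0 < h" for h
  proof (rule field_le_epsilon)
    fix e :: real assume "0 < e"
    from normal_chain_quad_coeff_null[OF F h this] obtain n :: nat
      where n: "cmod (of_real (exp (-2*(real n*h))) * quad_coeff (F (real n*h))) < e" .
    have "cmod (quad_coeff (F 0) - of_real (exp (-2*(real n*h))) * quad_coeff (F (real n*h)))
        \<le> ?c * exp h * (exp h + 1) * (1 - exp (-(real n*h)))"
      using h by (intro Loewner_chain_telescope[OF chain]) simp
    also have "\<dots> \<le> ?c * exp h * (exp h + 1) * 1" by (intro mult_left_mono) auto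
    finally show "cmod (quad_coeff (F 0)) \<le> ?c * exp h * (exp h + 1) + e"
      using n norm_triangle_sub[of "quad_coeff (F 0)" "of_real (exp (-2*(real n*h))) * quad_coeff (F (real n*h))"]
      by simp
  qed
  have "((\<lambda>h. ?c * exp h * (exp h + 1)) \<longlongrightarrow> ?c * exp 0 * (exp 0 + 1)) (at_right 0)"
    by (intro tendsto_intros)
  moreover have "\<forall>\<^sub>F h in at_right 0. cmod (quad_coeff (F 0)) \<le> ?c * exp h * (exp h + 1)"
    using * by (auto simp: eventually_at_filter)
  ultimately have "cmod (quad_coeff (F 0)) \<le> ?c * exp 0 * (exp 0 + 1)"
    by (rule tendsto_lowerbound) simp
  then show ?thesis by simp
qed

text \<open>On the slice \<open>z\<^sub>1 = 0\<close> all terms with \<open>j > 0\<close> vanish and a power series in \<open>z\<^sub>2\<close> remains.\<close>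

lemma Taylor_coefficient_eq_quad_coeff:
  assumes f: "holomorphic_map_on f \<B>\<^sup>2" "f 0 = 0" "(f has_derivative (\<lambda>h. \<tau> *\<^sub>R h)) (at 0)"
    and a: "has_Taylor_expansion f a"
  shows "a 1 (0, 2) = quad_coeff f"
proof -
  from a obtain d where d: "d > 0" and sum: "\<And>z i. norm z < d \<Longrightarrow>
      ((\<lambda>(j, k). a i (j, k) * ((z $ 1) ^ j * (z $ 2) ^ k)) has_sum (f z $ i - z $ i)) {(j, k). j + k \<ge> 2}"
    unfolding has_Taylor_expansion_def eventually_nhds_metric by auto
  have "((\<lambda>x. f (vector [0, x]) $ 1 / x\<^sup>2) \<longlongrightarrow> a 1 (0, 0 + 2)) (at 0)"
  proof (rule powser_limit_0_strong[OF d, where a = "\<lambda>n. a 1 (0, n + 2)"])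
    fix x :: complex assume x: "x \<noteq> 0" "norm x < d"
    have "norm (vector [0, x] :: complex^2) < d" using x by (simp add: norm_vector2)
    from sum[OF this, of 1]
    have "((\<lambda>(j, k). a 1 (j, k) * (0 ^ j * x ^ k)) has_sum f (vector [0, x]) $ 1) {(j, k). j + k \<ge> 2}"
      by simp
    also have "?this \<longleftrightarrow> ((\<lambda>(j, k). a 1 (j, k) * (0 ^ j * x ^ k)) has_sum f (vector [0, x]) $ 1) (range (\<lambda>n. (0, n + 2)))"
    proof (rule has_sum_cong_neutral)
      fix p :: "nat \<times> nat" assume p: "p \<in> {(j, k). j + k \<ge> 2} - range (\<lambda>n. (0, n + 2))"
      obtain j k where jk: "p = (j, k)" by (cases p)
      have "j \<noteq> 0"
      proof
        assume "j = 0"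
        then have "p = (0, (k - 2) + 2)" using p jk by auto
        then show False using p by blast
      qed
      then show "(case p of (j, k) \<Rightarrow> a 1 (j, k) * (0 ^ j * x ^ k)) = 0" by (simp add: jk)
    qed auto
    also have "\<dots> \<longleftrightarrow> ((\<lambda>n. a 1 (0, n + 2) * x ^ (n + 2)) has_sum f (vector [0, x]) $ 1) UNIV"
      by (subst has_sum_reindex) (auto simp: inj_on_def comp_def)
    finally have "(\<lambda>n. a 1 (0, n + 2) * x ^ (n + 2) / x\<^sup>2) sums (f (vector [0, x]) $ 1 / x\<^sup>2)"
      by (intro sums_divide has_sum_imp_sums)
    then show "(\<lambda>n. a 1 (0, n + 2) * x ^ n) sums (f (vector [0, x]) $ 1 / x\<^sup>2)"
      using x by (simp add: power_add power2_eq_square)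
  qed
  then have "a 1 (0, 0 + 2) = quad_coeff f"
    by (rule LIM_unique[OF _ quad_coeff_tendsto[OF f]])
  then show ?thesis by (simp only: add_0)
qed

section \<open>The extremal map\<close>

text \<open>The constant is sharp: equality holds at \<open>u = 1 / \<surd>3\<close>, \<open>v\<^sup>2 = 2/3\<close>. In terms of
  \<open>c = \<surd>3 u\<close> the inequality at \<open>v\<^sup>2 = 1 - u\<^sup>2\<close> becomes \<open>(c - 1)\<^sup>2 (c + 2) \<ge> 0\<close>.\<close>

lemma cubic_bound:
  fixes u v :: real
  assumes "0 \<le> u" "u\<^sup>2 + v\<^sup>2 \<le> 1"
  shows "3 * sqrt 3 / 2 * u * v\<^sup>2 \<le> u\<^sup>2 + v\<^sup>2"
proof (cases "3 * sqrt 3 / 2 * u \<le> 1")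
  case True
  then have "3 * sqrt 3 / 2 * u * v\<^sup>2 \<le> 1 * v\<^sup>2" by (rule mult_right_mono) simp
  then show ?thesis by (simp add: add_increasing)
next
  case False
  define c where "c = sqrt 3 * u"
  have qu: "3 * sqrt 3 / 2 * u = 3 / 2 * c" and u2: "u\<^sup>2 = c\<^sup>2 / 3"
    by (auto simp: c_def power_mult_distrib)
  have "0 \<le> (c - 1)\<^sup>2 * (c + 2)" using assms by (simp add: c_def)
  then have c: "(1 - c\<^sup>2 / 3) * (3 / 2 * c - 1) \<le> c\<^sup>2 / 3"
    by (simp add: power2_eq_square algebra_simps)
  have "v\<^sup>2 * (3 / 2 * c - 1) \<le> (1 - c\<^sup>2 / 3) * (3 / 2 * c - 1)"
    using assms False unfolding qu u2 by (intro mult_right_mono) auto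
  with c have "v\<^sup>2 * (3 / 2 * c - 1) \<le> c\<^sup>2 / 3" by linarith
  then show ?thesis unfolding qu u2 by (simp add: algebra_simps)
qed

text \<open>Let \<open>N(m)\<close> be the left-hand side with \<open>l\<close> replaced by \<open>m\<close>; then \<open>N(1) = x\<^sup>2 + y\<^sup>2\<close>. By the
  preceding inequality \<open>N\<close> is nondecreasing wherever \<open>N \<le> 1\<close>. If \<open>N\<close> reached \<open>1\<close> somewhere in
  \<open>[l, 1]\<close>, it could not come back below \<open>1\<close> after the last such point.\<close>

lemma shear_flow_stays_in_ball:
  fixes x y l :: real
  assumes xy: "0 \<le> x" "x\<^sup>2 + y\<^sup>2 < 1" and l: "0 < l" "l \<le> 1"
  shows "(l * x + (l - l\<^sup>2) * (3 * sqrt 3 / 2) * y\<^sup>2)\<^sup>2 + (l * y)\<^sup>2 < 1"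
proof (rule ccontr)
  define q where "q = 3 * sqrt 3 / 2"
  define u where "u = (\<lambda>m. m * x + (m - m\<^sup>2) * q * y\<^sup>2)"
  define N where "N = (\<lambda>m. (u m)\<^sup>2 + (m * y)\<^sup>2)"
  assume "\<not> ?thesis"
  then have "1 \<le> N l" by (simp add: N_def u_def q_def)
  have Nc: "continuous_on A N" for A unfolding N_def u_def by (intro continuous_intros)
  define S where "S = {m \<in> {l..1}. 1 \<le> N m}"
  have "S = {l..1} \<inter> N -` {1..}" by (auto simp: S_def)
  then have "closed S"
    using continuous_closed_preimage[OF Nc[of "{l..1}"] closed_atLeastAtMost closed_atLeast] by simp
  have "S \<noteq> {}" using \<open>1 \<le> N l\<close> l by (auto simp: S_def)
  have bS: "bdd_above S" by (rule bdd_aboveI[of _ 1]) (auto simp: S_def)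
  define s where "s = Sup S"
  have "s \<in> S" unfolding s_def by (rule closed_contains_Sup[OF \<open>S \<noteq> {}\<close> bS \<open>closed S\<close>])
  then have s: "l \<le> s" "s \<le> 1" "1 \<le> N s" by (auto simp: S_def)
  \<comment> \<open>\<open>s\<close> is the last point with \<open>N \<ge> 1\<close>, so \<open>N\<close> does not decrease on \<open>[s, 1]\<close>.\<close>
  have "N s \<le> N 1"
  proof (rule DERIV_nonneg_imp_increasing_open[OF s(2)])
    fix m assume m: "s < m" "m < 1"
    have "m \<notin> S" using cSup_upper[OF _ bS] m(1) unfolding s_def[symmetric] by force
    then have N1: "N m < 1" using m s by (auto simp: S_def)
    have um: "0 \<le> u m" unfolding u_def using m s l xy
      by (intro add_nonneg_nonneg mult_nonneg_nonneg) (auto simp: q_def power2_eq_square mult_le_cancel_left1)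
    let ?D = "2 * u m * (x + (1 - 2 * m) * q * y\<^sup>2) + 2 * (m * y) * y"
    have "DERIV N m :> ?D"
      unfolding N_def u_def by (auto intro!: derivative_eq_intros simp: power2_eq_square)
    moreover have "0 \<le> ?D"
    proof -
      have "m * ?D = 2 * ((u m)\<^sup>2 + (m * y)\<^sup>2 - q * u m * (m * y)\<^sup>2)"
        unfolding u_def by (simp add: power2_eq_square algebra_simps)
      also have "\<dots> \<ge> 0" using cubic_bound[OF um, of "m * y"] N1 by (simp add: N_def q_def mult.assoc mult.left_commute)
      finally show ?thesis using m s l by (simp add: zero_le_mult_iff)
    qed
    ultimately show "\<exists>y. DERIV N m :> y \<and> 0 \<le> y" by blast
  qed (rule Nc)
  also have "N 1 = x\<^sup>2 + y\<^sup>2" by (simp add: N_def u_def)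
  finally show False using s(3) xy by simp
qed

lemma vec_nth_has_derivative: "((\<lambda>z :: complex^2. z $ i) has_derivative (\<lambda>h. h $ i)) (at z)"
  by (rule bounded_linear_imp_has_derivative[OF bounded_linear_vec_nth])

lemma Phi_has_derivative:
  "(\<Phi> has_derivative (\<lambda>h. vector [h $ 1 + of_real (3 * sqrt 3) * z $ 2 * h $ 2, h $ 2])) (at z)"
proof (rule vec_has_derivative)
  have "((\<lambda>z :: complex^2. z $ 1 + of_real (3 * sqrt 3 / 2) * (z $ 2)\<^sup>2) has_derivative
      (\<lambda>h. h $ 1 + of_real (3 * sqrt 3 / 2) * (of_nat 2 * h $ 2 * (z $ 2) ^ (2 - 1)))) (at z)"
    by (intro has_derivative_add has_derivative_mult_right has_derivative_power vec_nth_has_derivative)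
  then show "((\<lambda>z. \<Phi> z $ i) has_derivative (\<lambda>h. vector [h $ 1 + of_real (3 * sqrt 3) * z $ 2 * h $ 2, h $ 2] $ i)) (at z)" for i
    using exhaust_2[of i] vec_nth_has_derivative[of 2 z] unfolding \<Phi>_def
    by (auto simp: mult_ac)
qed

lemma univalent_scaled_Phi: "univalent_on (\<lambda>z. exp t *\<^sub>R \<Phi> z) U"
proof -
  have "holomorphic_map_on (\<lambda>z. exp t *\<^sub>R \<Phi> z) U"
    unfolding holomorphic_map_on_def
  proof (rule ballI, rule exI, rule conjI)
    show "((\<lambda>z. exp t *\<^sub>R \<Phi> z) has_derivative
        (\<lambda>h. exp t *\<^sub>R vector [h $ 1 + of_real (3 * sqrt 3) * z $ 2 * h $ 2, h $ 2])) (at z)" for z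
      by (rule has_derivative_scaleR_right[OF Phi_has_derivative])
  qed (simp add: vec_eq_iff forall_2 algebra_simps)
  moreover have "inj_on (\<lambda>z. exp t *\<^sub>R \<Phi> z) U"
    by (rule inj_onI) (auto simp: \<Phi>_def vec_eq_iff forall_2)
  ultimately show ?thesis by (simp add: univalent_on_def)
qed

text \<open>The preimage of \<open>e\<^sup>s \<Phi>(z)\<close> under \<open>e\<^sup>t \<Phi>\<close> is the shear \<open>w\<close> of \<open>z\<close>. Replacing its entries by
  their moduli only increases its norm, which reduces the claim to the real inequality above.\<close>

lemma scaled_Phi_image_mono:
  assumes "s \<le> t"
  shows "(\<lambda>z. exp s *\<^sub>R \<Phi> z) ` \<B>\<^sup>2 \<subseteq> (\<lambda>z. exp t *\<^sub>R \<Phi> z) ` \<B>\<^sup>2"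
proof
  fix p assume "p \<in> (\<lambda>z. exp s *\<^sub>R \<Phi> z) ` \<B>\<^sup>2"
  then obtain z where z: "z \<in> \<B>\<^sup>2" and p: "p = exp s *\<^sub>R \<Phi> z" by blast
  define l where "l = exp (s - t)"
  have l: "0 < l" "l \<le> 1" using assms by (auto simp: l_def)
  define q where "q = 3 * sqrt 3 / 2"
  define w :: "complex^2" where "w = vector [of_real l * z $ 1 + of_real ((l - l\<^sup>2) * q) * (z $ 2)\<^sup>2, of_real l * z $ 2]"
  have "(norm z)\<^sup>2 < 1" using z by (simp add: power_less_one_iff)
  then have z2: "(cmod (z $ 1))\<^sup>2 + (cmod (z $ 2))\<^sup>2 < 1" by (simp add: norm_complex2)
  have ll: "0 \<le> (l - l\<^sup>2) * q" using l by (simp add: q_def power2_eq_square mult_le_cancel_left1)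
  have "cmod (w $ 1) \<le> l * cmod (z $ 1) + (l - l\<^sup>2) * q * (cmod (z $ 2))\<^sup>2"
    unfolding w_def vector_2 using l ll
    by (intro order_trans[OF norm_triangle_ineq]) (simp only: norm_mult norm_power norm_of_real abs_of_pos abs_of_nonneg order_refl)
  then have "(cmod (w $ 1))\<^sup>2 \<le> (l * cmod (z $ 1) + (l - l\<^sup>2) * q * (cmod (z $ 2))\<^sup>2)\<^sup>2"
    by (rule power_mono) simp
  moreover have "cmod (w $ 2) = l * cmod (z $ 2)" using l by (simp add: w_def norm_mult)
  ultimately have "(norm w)\<^sup>2 < 1"
    using shear_flow_stays_in_ball[OF norm_ge_zero z2 l] by (simp add: norm_complex2 q_def)
  then have "w \<in> \<B>\<^sup>2" by (simp add: power_less_one_iff)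
  moreover have "\<Phi> w = l *\<^sub>R \<Phi> z"
    unfolding \<Phi>_def by (simp only: vec_eq_iff forall_2 vector_2 vector_scaleR_component)
      (simp add: w_def q_def scaleR_conv_of_real power_mult_distrib field_simps)
  then have "exp t *\<^sub>R \<Phi> w = p" by (simp add: p l_def flip: exp_add)
  ultimately show "p \<in> (\<lambda>z. exp t *\<^sub>R \<Phi> z) ` \<B>\<^sup>2" by blast
qed

lemma Phi_zero: "\<Phi> 0 = 0" by (simp add: \<Phi>_def vec_eq_iff forall_2)

lemma Phi_has_derivative_0: "(\<Phi> has_derivative (\<lambda>h. h)) (at 0)"
proof -
  have "(\<lambda>h :: complex^2. vector [h $ 1 + of_real (3 * sqrt 3) * 0 $ 2 * h $ 2, h $ 2]) = (\<lambda>h. h)"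
    by (simp add: fun_eq_iff vec_eq_iff forall_2)
  then show ?thesis using Phi_has_derivative[of 0] by simp
qed

lemma Phi_in_S0: "\<Phi> \<in> S0"
proof -
  define F where "F = (\<lambda>t z. exp t *\<^sub>R \<Phi> z)"
  have "normalized_Loewner_chain F"
    unfolding normalized_Loewner_chain_def F_def
    by (auto simp: univalent_scaled_Phi Phi_zero dest!: scaled_Phi_image_mono
        intro: has_derivative_scaleR_right[OF Phi_has_derivative_0])
  moreover have "{(\<lambda>z. exp (- t) *\<^sub>R F t z) | t. 0 \<le> t} \<subseteq> {\<Phi>}"
    by (auto simp: F_def simp flip: exp_add)
  then have "normal_family_on {(\<lambda>z. exp (- t) *\<^sub>R F t z) | t. 0 \<le> t} \<B>\<^sup>2"
    unfolding normal_family_on_def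
  proof (intro allI impI)
    fix \<phi> :: "nat \<Rightarrow> complex^2 \<Rightarrow> complex^2"
    assume "{(\<lambda>z. exp (- t) *\<^sub>R F t z) | t. 0 \<le> t} \<subseteq> {\<Phi>}"
      and "range \<phi> \<subseteq> {(\<lambda>z. exp (- t) *\<^sub>R F t z) | t. 0 \<le> t}"
    then have "range \<phi> \<subseteq> {\<Phi>}" by (rule subset_trans[rotated])
    then have "\<phi> = (\<lambda>n. \<Phi>)" by auto
    then show "\<exists>r g. strict_mono r \<and> (\<forall>K. compact K \<and> K \<subseteq> \<B>\<^sup>2 \<longrightarrow> uniform_limit K (\<phi> \<circ> r) g sequentially)"
      by (intro exI[of _ id] exI[of _ \<Phi>]) (auto simp: strict_mono_def uniform_limit_const)
  qed
  ultimately have "normal_Loewner_chain F" by (simp add: normal_Loewner_chain_def)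
  moreover have "F 0 z = \<Phi> z" for z by (simp add: F_def)
  moreover have "univalent_on \<Phi> \<B>\<^sup>2" using univalent_scaled_Phi[of 0] by simp
  ultimately show ?thesis unfolding S0_def using Phi_zero Phi_has_derivative_0 by blast
qed

lemma Phi_Taylor_expansion:
  "has_Taylor_expansion \<Phi> (\<lambda>i p. if i = 1 \<and> p = (0, 2) then of_real (3 * sqrt 3 / 2) else 0)"
  (is "has_Taylor_expansion \<Phi> ?a")
  unfolding has_Taylor_expansion_def
proof (intro always_eventually allI)
  fix z :: "complex^2" and i :: 2
  let ?t = "\<lambda>(j, k). ?a i (j, k) * ((z $ 1) ^ j * (z $ 2) ^ k)"
  have "(?t has_sum (\<Phi> z $ i - z $ i)) {(0, 2)}"
    using exhaust_2[of i] by (auto simp: \<Phi>_def has_sum_finite_iff)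
  moreover have "(?t has_sum (\<Phi> z $ i - z $ i)) {(0, 2)} \<longleftrightarrow> (?t has_sum (\<Phi> z $ i - z $ i)) {(j, k). j + k \<ge> 2}"
    by (rule has_sum_cong_neutral) (auto split: if_splits)
  ultimately show "(?t has_sum (\<Phi> z $ i - z $ i)) {(j, k). j + k \<ge> 2}" by blast
qed

section \<open>The sharp bound\<close>

lemma S0_coefficient_bound:
  assumes "f \<in> S0" and a: "has_Taylor_expansion f a"
  shows "cmod (a 1 (0, 2)) \<le> 3 * sqrt 3 / 2"
proof -
  obtain F where F: "normal_Loewner_chain F" and eq: "\<And>z. z \<in> \<B>\<^sup>2 \<Longrightarrow> F 0 z = f z"
    using assms(1) unfolding S0_def by blast
  have F0: "holomorphic_map_on (F 0) \<B>\<^sup>2" "F 0 0 = 0" "(F 0 has_derivative (\<lambda>h. exp 0 *\<^sub>R h)) (at 0)"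
    using F by (auto simp: normal_Loewner_chain_def normalized_Loewner_chain_def univalent_on_def
        simp del: exp_zero)
  have "\<forall>\<^sub>F z in nhds 0. z \<in> \<B>\<^sup>2" by (rule eventually_nhds_in_open) auto
  then have "has_Taylor_expansion (F 0) a"
    using a unfolding has_Taylor_expansion_def by eventually_elim (simp add: eq)
  from Taylor_coefficient_eq_quad_coeff[OF F0 this] show ?thesis
    using normal_chain_quad_coeff_bound[OF F] by simp
qed

theorem theorem1p2:
  "(\<forall>f\<in>S0. \<forall>a. has_Taylor_expansion f a \<longrightarrow> cmod (a 1 (0, 2)) \<le> 3 * sqrt 3 / 2) \<and>
   \<Phi> \<in> S0 \<and>
   (\<exists>a. has_Taylor_expansion \<Phi> a \<and> cmod (a 1 (0, 2)) = 3 * sqrt 3 / 2)"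
proof (intro conjI ballI allI impI exI)
  show "has_Taylor_expansion \<Phi> (\<lambda>i p. if i = 1 \<and> p = (0, 2) then of_real (3 * sqrt 3 / 2) else 0)"
    by (rule Phi_Taylor_expansion)
  show "cmod (if (1::2) = 1 \<and> (0::nat, 2::nat) = (0, 2) then of_real (3 * sqrt 3 / 2) else 0) = 3 * sqrt 3 / 2"
    by (simp add: norm_mult norm_divide)
  show "\<Phi> \<in> S0" by (rule Phi_in_S0)
  show "cmod (a 1 (0, 2)) \<le> 3 * sqrt 3 / 2" if "f \<in> S0" "has_Taylor_expansion f a" for f a
    using that by (rule S0_coefficient_bound)
qed

end
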